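(* Let $(W,S)$ be a Coxeter system of type $A_n$ ($n\ge 1$), $B_n$ ($n\ge 2$) or $D_n$ ($n\ge 3$). Then the algebra $\mathfrak{E}(W)=\mathbb{Q}[x_{n-1}]$ admits a native basis, consisting of all basis elements of $\Sigma(W)$ corresponding to left-connected subgroups of $W$, i.e. $\{x_0,x_1,\dots,x_n\}$ for types $A_n$ and $B_n$, and $\{x_1,\dots,x_n\}$ for type $D_n$. Moreover, all elements of this native basis are integral polynomials in $x_{n-1}$ (polynomials in $x_{n-1}$ with coefficients in $\mathbb{Z}$).
   Context: For a finite Coxeter system $(W,S)$ with length function $\ell$ and $J\subseteq S$, let $W_J=\langle J\rangle$, $X_J=\{w\in W: \ell(ws)>\ell(w)\text{ for all } s\in J\}$ and $x_J=\sum_{w\in X_J} w\in\mathbb{Q}W$. The elements $x_J$ are linearly independent and their span $\Sigma(W)$ is a subalgebra of $\mathbb{Q}W$ with identity $x_S=1$ (the descent algebra). A basis of a subalgebra of $\Sigma(W)$ is native if it is a subset of $\{x_J: J\subseteq S\}$. Label $S=\{s_1,\dots,s_n\}$ as follows ($m(s,t)$ is the order of $st$; unmentioned pairs commute): type $A_n$: $m(s_i,s_{i+1})=3$ for $1\le i\le n-1$; type $B_n$: $m(s_1,s_2)=4$, $m(s_i,s_{i+1})=3$ for $2\le i\le n-1$; type $D_n$: $m(s_1,s_3)=m(s_2,s_3)=3$, $m(s_i,s_{i+1})=3$ for $3\le i\le n-1$. For $0\le j\le n$ put $W_j=W_{\{s_1,\dots,s_j\}}$ and $x_j=x_{\{s_1,\dots,s_j\}}$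 (so $x_n=1$), except that in type $D_n$ one uses only $1\le j\le n$ and sets $W_1=W_\emptyset$ and $x_1=x_\emptyset$. The subgroups $W_j$ ($0\le j\le n$ for types $A_n,B_n$; $1\le j\le n$ for type $D_n$) are the left-connected subgroups, and $x_j$ is the basis element corresponding to $W_j$. $\mathfrak{E}(W)=\mathbb{Q}[x_{n-1}]$ is the unital subalgebra of $\Sigma(W)$ generated by $x_{n-1}$. *)

theory Defs
  imports
    Complex_Main
    "HOL-Library.Poly_Mapping"
    "HOL-Computational_Algebra.Polynomial"
begin

text \<open>
  The group W is a type of class \<open>group_add\<close>, the library's class of groups that need not be
  commutative.  It is written additively: \<open>+\<close> is the group product, \<open>0\<close> its identity, and
  \<open>sum_list\<close> the product of a word, read from left to right.  With this choice the library type
  \<open>'w \<Rightarrow>\<^sub>0 rat\<close> (finitely supported functions, with the convolution product written \<open>*\<close>) is the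
  rational group algebra of W.
\<close>


section \<open>Coxeter systems\<close>

text \<open>As usual in the library, an element of infinite order has order 0.\<close>

definition elem_order :: "'w::group_add \<Rightarrow> nat" where
  "elem_order w =
     (if \<exists>k>0. sum_list (replicate k w) = 0
      then LEAST k. k > 0 \<and> sum_list (replicate k w) = 0 else 0)"

text \<open>
  Insertion of one of the relators \<open>(st)\<^sup>m\<close> into a word, where m is the order of \<open>st\<close> in W.
  For \<open>s = t\<close> the relator is \<open>ss\<close>.  If \<open>st\<close> has infinite order the relator is the empty word.
\<close>

inductive insert_relator :: "'w::group_add set \<Rightarrow> 'w list \<Rightarrow> 'w list \<Rightarrow> bool"
  for S :: "'w set" where
  "s \<in> S \<Longrightarrow> t \<in> S \<Longrightarrow>
     insert_relator S (u @ v) (u @ concat (replicate (elem_order (s + t)) [s, t]) @ v)"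

text \<open>
  \<open>(W, S)\<close> is a Coxeter system: S is a set of involutions that generates W, and the relations
  \<open>(st)^m(s,t) = 1\<close> form a presentation of W.  Because \<open>ss\<close> is one of the relators, no letters for
  inverses are needed, so words are lists over S.
\<close>

definition coxeter_system :: "'w::group_add set \<Rightarrow> bool" where
  "coxeter_system S \<longleftrightarrow>
     (\<forall>s\<in>S. elem_order s = 2) \<and>
     (\<forall>w. \<exists>us\<in>lists S. sum_list us = w) \<and>
     (\<forall>us\<in>lists S. \<forall>vs\<in>lists S.
        sum_list us = sum_list vs \<longrightarrow> equivclp (insert_relator S) us vs)"

definition cox_length :: "'w::group_add set \<Rightarrow> 'w \<Rightarrow> nat" where
  "cox_length S w = (LEAST k. \<exists>us\<in>lists S. length us = k \<and> sum_list us = w)"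


section \<open>The descent algebra\<close>

definition scale :: "rat \<Rightarrow> ('w \<Rightarrow>\<^sub>0 rat) \<Rightarrow> ('w \<Rightarrow>\<^sub>0 rat)" where
  "scale c f = Poly_Mapping.map ((*) c) f"

lemma lookup_scale: "Poly_Mapping.lookup (scale c f) w = c * Poly_Mapping.lookup f w"
  unfolding scale_def by transfer (simp add: when_def)

interpretation group_algebra: vector_space scale
  by unfold_locales (auto intro!: poly_mapping_eqI simp: lookup_scale lookup_add algebra_simps)

definition X_set :: "'w::group_add set \<Rightarrow> 'w set \<Rightarrow> 'w set" where
  "X_set S J = {w. \<forall>s\<in>J. cox_length S (w + s) > cox_length S w}"

text \<open>Meaningful only if \<open>X_set S J\<close> is finite, in particular if W is finite.\<close>

definition x_elem :: "'w::group_add set \<Rightarrow> 'w set \<Rightarrow> 'w \<Rightarrow>\<^sub>0 rat" where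
  "x_elem S J = (\<Sum>w\<in>X_set S J. Poly_Mapping.single w 1)"

definition descent_algebra :: "'w::group_add set \<Rightarrow> ('w \<Rightarrow>\<^sub>0 rat) set" where
  "descent_algebra S = group_algebra.span {x_elem S J |J. J \<subseteq> S}"

definition subalgebra :: "('w::group_add \<Rightarrow>\<^sub>0 rat) set \<Rightarrow> bool" where
  "subalgebra A \<longleftrightarrow> group_algebra.subspace A \<and> (\<forall>a\<in>A. \<forall>b\<in>A. a * b \<in> A)"

definition unital_subalgebra :: "('w::group_add \<Rightarrow>\<^sub>0 rat) set \<Rightarrow> bool" where
  "unital_subalgebra A \<longleftrightarrow> subalgebra A \<and> 1 \<in> A"

definition native_basis ::
    "'w::group_add set \<Rightarrow> ('w \<Rightarrow>\<^sub>0 rat) set \<Rightarrow> ('w \<Rightarrow>\<^sub>0 rat) set \<Rightarrow> bool" where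
  "native_basis S A B \<longleftrightarrow>
     subalgebra A \<and> A \<subseteq> descent_algebra S \<and>
     group_algebra.independent B \<and> group_algebra.span B = A \<and>
     B \<subseteq> {x_elem S J |J. J \<subseteq> S}"

text \<open>The evaluation function of the library is restricted to commutative rings.\<close>

definition int_poly_eval :: "int poly \<Rightarrow> 'a::ring_1 \<Rightarrow> 'a" where
  "int_poly_eval p a = (\<Sum>i\<le>degree p. of_int (coeff p i) * a ^ i)"


section \<open>The types A, B, D and the left-connected subgroups\<close>

datatype cox_series = A_series | B_series | D_series

fun min_rank :: "cox_series \<Rightarrow> nat" where
  "min_rank A_series = 1"
| "min_rank B_series = 2"
| "min_rank D_series = 3"

text \<open>
  The entry \<open>m(s\<^sub>i, s\<^sub>j)\<close> of the Coxeter matrix for \<open>i < j\<close>, where the generators are numbered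
  from 1.  The special nodes are \<open>s\<^sub>1\<close> and \<open>s\<^sub>2\<close>: in type B they span the edge labelled 4, in type D
  they are the two leaves attached to \<open>s\<^sub>3\<close>.
\<close>

fun cox_entry :: "cox_series \<Rightarrow> nat \<Rightarrow> nat \<Rightarrow> nat" where
  "cox_entry A_series i j = (if j = i + 1 then 3 else 2)"
| "cox_entry B_series i j =
     (if i = 1 \<and> j = 2 then 4 else if j = i + 1 then 3 else 2)"
| "cox_entry D_series i j =
     (if i = 1 \<and> j = 3 then 3 else if i \<ge> 2 \<and> j = i + 1 then 3 else 2)"

definition coxeter_system_of_type ::
    "cox_series \<Rightarrow> nat \<Rightarrow> 'w::group_add set \<Rightarrow> (nat \<Rightarrow> 'w) \<Rightarrow> bool" where
  "coxeter_system_of_type T n S s \<longleftrightarrow>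
     n \<ge> min_rank T \<and> coxeter_system S \<and> bij_betw s {1..n} S \<and>
     (\<forall>i j. 1 \<le> i \<and> i < j \<and> j \<le> n \<longrightarrow> elem_order (s i + s j) = cox_entry T i j)"

text \<open>The indices j of the left-connected subgroups \<open>W\<^sub>j\<close>.\<close>

fun left_connected_indices :: "cox_series \<Rightarrow> nat \<Rightarrow> nat set" where
  "left_connected_indices A_series n = {0..n}"
| "left_connected_indices B_series n = {0..n}"
| "left_connected_indices D_series n = {1..n}"

text \<open>The generators of \<open>W\<^sub>j\<close>.  In type D the convention is that \<open>W\<^sub>1\<close> is trivial.\<close>

definition left_connected_gens :: "cox_series \<Rightarrow> (nat \<Rightarrow> 'w) \<Rightarrow> nat \<Rightarrow> 'w set" where
  "left_connected_gens T s j = (if T = D_series \<and> j = 1 then {} else s ` {1..j})"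

definition x_left ::
    "cox_series \<Rightarrow> 'w::group_add set \<Rightarrow> (nat \<Rightarrow> 'w) \<Rightarrow> nat \<Rightarrow> 'w \<Rightarrow>\<^sub>0 rat" where
  "x_left T S s j = x_elem S (left_connected_gens T s j)"

definition left_connected_algebra ::
    "cox_series \<Rightarrow> nat \<Rightarrow> 'w::group_add set \<Rightarrow> (nat \<Rightarrow> 'w) \<Rightarrow> ('w \<Rightarrow>\<^sub>0 rat) set" where
  "left_connected_algebra T n S s = unital_subalgebra hull {x_left T S s (n - 1)}"

end

theory Submission
  imports Defs
begin

text \<open>
  Let \<open>d\<^sub>m\<close> be the sum of the minimal representatives of the left cosets of \<open>W\<^bsub>m-1\<^esub>\<close> in \<open>W\<^sub>m\<close>.
  Lengths add up along the chain of subgroups, so \<open>x\<^sub>j = d\<^sub>n \<cdots> d\<^bsub>j+1\<^esub>\<close>.  The representatives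
  satisfy \<open>d\<^bsub>m+1\<^esub> = 1 + d\<^sub>m s\<^bsub>m+1\<^esub> + e\<^bsub>m+1\<^esub>\<close>, where \<open>e\<^bsub>m+1\<^esub> = s\<^bsub>m+1\<^esub> e\<^sub>m s\<^bsub>m+1\<^esub>\<close> is an involution
  in types B and D and is absent in type A.  Since \<open>d\<^sub>m e\<^sub>m = d\<^sub>m\<close> and
  \<open>d\<^sub>m d\<^bsub>m-1\<^esub> s\<^sub>m = d\<^sub>m d\<^bsub>m-1\<^esub>\<close>, this gives \<open>d\<^sub>m\<^sup>2 = k d\<^sub>m + d\<^sub>m d\<^bsub>m-1\<^esub>\<close> with \<open>k = 1\<close> in type A
  and \<open>k = 2\<close> in types B and D, and hence \<open>x\<^bsub>n-1\<^esub> x\<^sub>j = k (n - j) x\<^sub>j + x\<^bsub>j-1\<^esub>\<close>.  This recursion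
  expresses every \<open>x\<^sub>j\<close> as an integral polynomial in \<open>x\<^bsub>n-1\<^esub>\<close>; it ends because \<open>x\<^bsub>n-1\<^esub>\<close> multiplies
  the last \<open>x\<^sub>j\<close>, the sum of all elements of \<open>W\<close>, by an integer.  The \<open>x\<^sub>j\<close> are linearly independent because
  the support of \<open>x\<^sub>j\<close> contains \<open>s\<^bsub>j+1\<^esub>\<close>, unlike those of \<open>x\<^bsub>j+1\<^esub>, \<dots>, x\<^sub>n\<close>.
  That distinct representatives lie in distinct cosets is seen in the representation of \<open>W\<close>
  by signed permutations, which exists by the presentation.
\<close>

section \<open>Sums over subsets in the group algebra\<close>

definition group_sum :: "'w::group_add set \<Rightarrow> 'w \<Rightarrow>\<^sub>0 rat" where
  "group_sum A = (\<Sum>w\<in>A. Poly_Mapping.single w 1)"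

abbreviation elt :: "'w::group_add \<Rightarrow> 'w \<Rightarrow>\<^sub>0 rat" where
  "elt w \<equiv> Poly_Mapping.single w 1"

lemma elt_mult: "elt a * elt b = elt (a + b)"
  by (simp add: mult_single)

lemma lookup_group_sum:
  "finite A \<Longrightarrow> Poly_Mapping.lookup (group_sum A) w = (if w \<in> A then 1 else 0)"
  by (simp add: group_sum_def lookup_sum lookup_single when_def)

lemma group_sum_Un:
  "finite A \<Longrightarrow> finite B \<Longrightarrow> A \<inter> B = {} \<Longrightarrow> group_sum (A \<union> B) = group_sum A + group_sum B"
  by (simp add: group_sum_def sum.union_disjoint)

lemma group_sum_translate_right: "group_sum ((\<lambda>x. x + a) ` A) = group_sum A * elt a"
  by (simp add: group_sum_def sum.reindex inj_on_def sum_distrib_right elt_mult)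

lemma group_sum_translate_left: "group_sum ((\<lambda>x. a + x) ` A) = elt a * group_sum A"
  by (simp add: group_sum_def sum.reindex inj_on_def sum_distrib_left elt_mult)

lemma group_sum_set_add:
  assumes "inj_on (\<lambda>(a, b). a + b) (A \<times> B)"
  shows "group_sum {a + b | a b. a \<in> A \<and> b \<in> B} = group_sum A * group_sum B"
proof -
  have "{a + b | a b. a \<in> A \<and> b \<in> B} = (\<lambda>(a, b). a + b) ` (A \<times> B)"
    by auto
  then show ?thesis
    using assms
    by (simp add: group_sum_def sum.reindex sum_product sum.cartesian_product elt_mult case_prod_unfold)
qed

section \<open>Scalars in the group algebra\<close>

lemma scale_conv_mult: "scale c f = Poly_Mapping.single 0 c * f"
  by (simp add: scale_def mult_map_scale_conv_mult)

text \<open>Adding one support point at a time reduces this to monomials, where 0 is neutral in the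
  group and the coefficients commute. It lets scalars be pulled out of the right factor of a
  product.\<close>

lemma single_zero_central:
  fixes f :: "'w::group_add \<Rightarrow>\<^sub>0 rat"
  shows "Poly_Mapping.single 0 c * f = f * Poly_Mapping.single 0 c"
proof (induction f rule: update_induct)
  case (update f a b)
  \<comment> \<open>\<open>a\<close> lies outside the support of \<open>f\<close>, so the update
    just adds a term.\<close>
  then have "Poly_Mapping.update a b f = f + Poly_Mapping.single a b"
    by (intro poly_mapping_eqI) (auto simp: lookup_update lookup_add lookup_single when_def in_keys_iff)
  with update show ?case
    by (simp add: mult_single distrib_left distrib_right mult.commute)
qed simp

lemma scale_mult_left: "scale c f * g = scale c (f * g)"
  for f g :: "'w::group_add \<Rightarrow>\<^sub>0 rat"
  by (simp add: scale_conv_mult mult.assoc)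

lemma scale_mult_right: "f * scale c g = scale c (f * g)"
  for f g :: "'w::group_add \<Rightarrow>\<^sub>0 rat"
  by (metis scale_conv_mult mult.assoc single_zero_central)

lemma of_nat_mult_eq_scale: "of_nat k * f = scale (of_nat k) f"
  for f :: "'w::group_add \<Rightarrow>\<^sub>0 rat"
  by (induction k) (simp_all add: group_algebra.scale_left_distrib distrib_right)

section \<open>Integral polynomials\<close>

lemma int_poly_eval_eq_sum:
  assumes "degree p \<le> N"
  shows "int_poly_eval p a = (\<Sum>i\<le>N. of_int (coeff p i) * a ^ i)"
  unfolding int_poly_eval_def
  using assms by (intro sum.mono_neutral_left) (auto simp: coeff_eq_0)

lemma int_poly_eval_add: "int_poly_eval (p + q) a = int_poly_eval p a + int_poly_eval q a"
proof -
  let ?N = "max (degree p) (degree q)"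
  show ?thesis
    using degree_add_le_max[of p q]
    by (simp add: int_poly_eval_eq_sum[where N = ?N] distrib_right sum.distrib)
qed

lemma int_poly_eval_smult: "int_poly_eval (smult c p) a = of_int c * int_poly_eval p a"
  by (simp add: int_poly_eval_eq_sum[where N = "degree p"] degree_smult_le sum_distrib_left mult.assoc)

text \<open>Horner's rule survives without commutativity because integers are central in every
  ring.\<close>

lemma int_poly_eval_pCons: "int_poly_eval (pCons c p) a = of_int c + a * int_poly_eval p a"
proof -
  have "a * (of_int k * b) = of_int k * (a * b)" for k b
    by (metis mult.assoc mult_of_int_commute)
  then show ?thesis
    by (simp add: int_poly_eval_eq_sum[where N = "Suc (degree p)"] degree_pCons_le sum.atMost_Suc_shift
        int_poly_eval_def sum_distrib_left del: sum.atMost_Suc)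
qed

lemma int_poly_eval_one: "int_poly_eval 1 a = 1"
  by (simp add: int_poly_eval_def)

section \<open>Words and lengths\<close>

text \<open>When the letters are involutions, words without inverses already give the parabolic
  subgroup \<open>W\<^sub>J\<close>.\<close>

definition gen :: "'w::group_add set \<Rightarrow> 'w set" where
  "gen J = sum_list ` lists J"

lemma gen_zero: "0 \<in> gen J"
  unfolding gen_def by (force intro: image_eqI[of _ _ "[]"])

lemma gen_incl: "t \<in> J \<Longrightarrow> t \<in> gen J"
  unfolding gen_def by (force intro: image_eqI[of _ _ "[t]"])

lemma gen_add:
  assumes "a \<in> gen J" "b \<in> gen J"
  shows "a + b \<in> gen J"
proof -
  obtain us vs where "us \<in> lists J" "vs \<in> lists J" "a = sum_list us" "b = sum_list vs"
    using assms by (auto simp: gen_def)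
  then show ?thesis
    unfolding gen_def by (intro image_eqI[of _ _ "us @ vs"]) auto
qed

lemma gen_mono: "I \<subseteq> J \<Longrightarrow> gen I \<subseteq> gen J"
  unfolding gen_def using lists_mono by blast

lemma gen_induct [consumes 1, case_names zero add]:
  assumes "w \<in> gen J" "P 0" "\<And>t w. t \<in> J \<Longrightarrow> w \<in> gen J \<Longrightarrow> P w \<Longrightarrow> P (t + w)"
  shows "P w"
proof -
  have "P (sum_list us)" if "us \<in> lists J" for us
    using that by (induction us) (use assms in \<open>auto simp: gen_def\<close>)
  then show ?thesis using assms(1) by (auto simp: gen_def)
qed

lemma gen_commute:
  assumes "w \<in> gen J" "\<And>t. t \<in> J \<Longrightarrow> x + t = t + x"
  shows "x + w = w + x"
  using assms(1) by (induction rule: gen_induct) (simp_all add: assms(2) add.assoc flip: add.assoc[of x])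

lemma cox_length_le: "us \<in> lists J \<Longrightarrow> cox_length J (sum_list us) \<le> length us"
  unfolding cox_length_def by (rule Least_le) auto

lemma cox_length_word:
  assumes "w \<in> gen J"
  obtains us where "us \<in> lists J" "length us = cox_length J w" "sum_list us = w"
proof -
  have "\<exists>k. \<exists>us\<in>lists J. length us = k \<and> sum_list us = w"
    using assms by (auto simp: gen_def)
  from LeastI_ex[OF this] show ?thesis
    using that by (auto simp: cox_length_def)
qed

lemma cox_length_zero: "cox_length J 0 = 0"
  using cox_length_le[of "[]" J] by simp

lemma cox_length_pos: "w \<in> gen J \<Longrightarrow> w \<noteq> 0 \<Longrightarrow> 0 < cox_length J w"
  by (erule cox_length_word) (use gr0I in fastforce)

lemma cox_length_add_le:
  assumes "a \<in> gen J" "b \<in> gen J"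
  shows "cox_length J (a + b) \<le> cox_length J a + cox_length J b"
proof -
  obtain us vs where us: "us \<in> lists J" "length us = cox_length J a" "sum_list us = a"
    and vs: "vs \<in> lists J" "length vs = cox_length J b" "sum_list vs = b"
    using assms by (metis cox_length_word)
  then show ?thesis
    using cox_length_le[of "us @ vs" J] by simp
qed

lemma cox_length_gen_le: "t \<in> J \<Longrightarrow> cox_length J t \<le> 1"
  using cox_length_le[of "[t]" J] by simp

lemma cox_length_mono:
  assumes "I \<subseteq> J" "w \<in> gen I"
  shows "cox_length J w \<le> cox_length I w"
proof -
  obtain us where "us \<in> lists I" "length us = cox_length I w" "sum_list us = w"
    using assms(2) by (rule cox_length_word)
  then show ?thesis
    using cox_length_le[of us J] assms(1) lists_mono[of I J] by auto
qed

text \<open>The source of lower bounds on lengths: a function rising by at most one per letter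
  cannot exceed the number of letters of a shortest word.\<close>

lemma le_cox_length:
  assumes "w \<in> gen J" "f 0 = 0" "\<And>t w. t \<in> J \<Longrightarrow> w \<in> gen J \<Longrightarrow> f (t + w) \<le> Suc (f w)"
  shows "f w \<le> cox_length J w"
proof -
  have "f (sum_list us) \<le> length us" if "us \<in> lists J" for us
    using that
  proof (induction us)
    case (Cons t us)
    then have "f (t + sum_list us) \<le> Suc (f (sum_list us))"
      by (intro assms(3)) (auto simp: gen_def)
    with Cons show ?case by auto
  qed (simp add: assms)
  then show ?thesis using assms(1) by (metis cox_length_word)
qed

text \<open>Setwise equality of the translates allows \<open>e\<close> to permute \<open>Z\<close>
  by conjugation, as happens in type D, and still makes \<open>elt e\<close> commute with the sum
  over \<open>Z\<close>.\<close>

definition normalizes :: "'w::group_add \<Rightarrow> 'w set \<Rightarrow> bool" where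
  "normalizes e Z \<longleftrightarrow> (\<lambda>x. e + x) ` Z = (\<lambda>x. x + e) ` Z"

lemma normalizes_group_sum: "normalizes e Z \<Longrightarrow> elt e * group_sum Z = group_sum Z * elt e"
  by (metis normalizes_def group_sum_translate_left group_sum_translate_right)

lemma normalizes_Un: "normalizes e A \<Longrightarrow> normalizes e B \<Longrightarrow> normalizes e (A \<union> B)"
  by (simp add: normalizes_def image_Un)

lemma normalizes_commuting: "(\<And>x. x \<in> A \<Longrightarrow> e + x = x + e) \<Longrightarrow> normalizes e A"
  by (simp add: normalizes_def)

lemma normalizes_translate:
  assumes "normalizes e A" "e + t = t + e"
  shows "normalizes e ((\<lambda>x. x + t) ` A)"
proof -
  have "(\<lambda>x. e + x) ` (\<lambda>x. x + t) ` A = (\<lambda>x. x + t) ` (\<lambda>x. e + x) ` A"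
    by (simp add: image_image add.assoc)
  also have "\<dots> = (\<lambda>x. x + t) ` (\<lambda>x. x + e) ` A"
    using assms by (simp add: normalizes_def)
  also have "\<dots> = (\<lambda>x. x + e) ` (\<lambda>x. x + t) ` A"
    using assms by (simp add: image_image add.assoc)
  finally show ?thesis by (simp add: normalizes_def)
qed

lemma normalizes_translate_left:
  assumes "normalizes e A" "e + t = t + e"
  shows "normalizes e ((\<lambda>x. t + x) ` A)"
proof -
  have "(\<lambda>x. e + x) ` (\<lambda>x. t + x) ` A = (\<lambda>x. t + x) ` (\<lambda>x. e + x) ` A"
    by (simp add: image_image assms(2) flip: add.assoc)
  also have "\<dots> = (\<lambda>x. t + x) ` (\<lambda>x. x + e) ` A"
    using assms by (simp add: normalizes_def)
  also have "\<dots> = (\<lambda>x. x + e) ` (\<lambda>x. t + x) ` A"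
    by (simp add: image_image add.assoc)
  finally show ?thesis by (simp add: normalizes_def)
qed

text \<open>Since \<open>t\<close> commutes with all of \<open>A\<close>, elements of
  \<open>A\<close> pass through the outer factors, and both translates arise from those of
  \<open>e\<close> by surrounding with \<open>t\<close>.\<close>

lemma normalizes_conj:
  assumes "normalizes e A" "\<And>x. x \<in> A \<Longrightarrow> t + x = x + t"
  shows "normalizes (t + e + t) A"
proof -
  have "(\<lambda>x. (t + e + t) + x) ` A = (\<lambda>x. t + x + t) ` (\<lambda>x. e + x) ` A"
    using assms(2) by (auto simp: image_image add.assoc intro!: image_cong)
  also have "\<dots> = (\<lambda>x. t + x + t) ` (\<lambda>x. x + e) ` A"
    using assms by (simp add: normalizes_def)
  also have "\<dots> = (\<lambda>x. x + (t + e + t)) ` A"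
    using assms(2) by (auto simp: image_image intro!: image_cong simp flip: add.assoc)
  finally show ?thesis by (simp add: normalizes_def)
qed

section \<open>Chains of parabolic subgroups\<close>

text \<open>
  \<open>J j\<close> generates \<open>W\<^sub>j\<close>, and \<open>l\<close> is the index of the trivial group of the chain: 0 for A and B,
  1 for D.  The minimal coset representatives of \<open>W\<^bsub>l+1\<^esub>\<close> (the whole group) are \<open>{0} \<union> K \<union> E0\<close>,
  where \<open>E0\<close> holds the longest one in types B and D and is empty in type A.  The map \<open>act\<close> is an
  action by signed permutations; \<open>W\<^bsub>m-1\<^esub>\<close> fixes the point \<open>m + c\<close>, whose image under an element
  of \<open>W\<^sub>m\<close> tells the cosets apart.
\<close>

locale left_connected_chain =
  fixes S :: "'w::group_add set" and s :: "nat \<Rightarrow> 'w" and J :: "nat \<Rightarrow> 'w set"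
    and K E0 :: "'w set" and l n :: nat and act :: "'w \<Rightarrow> int \<Rightarrow> int" and c :: int
  assumes l_less: "l < n"
    and J_bot: "J l = {}" and J_top: "J n = S"
    and J_Suc: "\<And>m. l < m \<Longrightarrow> m < n \<Longrightarrow> J (Suc m) = insert (s (Suc m)) (J m)"
    and gen_S: "gen S = UNIV"
    and involution: "\<And>t. t \<in> S \<Longrightarrow> t + t = 0" and nontrivial: "\<And>t. t \<in> S \<Longrightarrow> t \<noteq> 0"
    and s_commute: "\<And>m t. l < m \<Longrightarrow> m < n \<Longrightarrow> t \<in> J (m - 1) \<Longrightarrow> s (Suc m) + t = t + s (Suc m)"
    and s_braid: "\<And>m. Suc l < m \<Longrightarrow> m < n \<Longrightarrow>
      s m + s (Suc m) + s m = s (Suc m) + s m + s (Suc m)"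
    and finite_base: "finite K" "finite E0"
    and K_sub: "K \<subseteq> J (Suc l)" and E0_sub: "E0 \<subseteq> gen (J (Suc l))"
    and E0_cases: "E0 = {} \<or> (\<exists>e. E0 = {e})"
    and E0_involution: "\<And>e. e \<in> E0 \<Longrightarrow> e + e = 0"
    and base_disjoint: "0 \<notin> K" "0 \<notin> E0" "K \<inter> E0 = {}"
    and s_in_K: "s (Suc l) \<in> K \<union> E0" "s (Suc l) \<in> J (Suc l)"
    and K_braid: "\<And>k. Suc l < n \<Longrightarrow> k \<in> K \<Longrightarrow>
      k + s (Suc (Suc l)) + k = s (Suc (Suc l)) + k + s (Suc (Suc l))"
    and base_closed: "\<And>t d. t \<in> J (Suc l) \<Longrightarrow> d \<in> insert 0 (K \<union> E0) \<Longrightarrow>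
      t + d \<in> insert 0 (K \<union> E0) \<and> d + t \<in> insert 0 (K \<union> E0)"
    and base_normalizes: "\<And>e. Suc l < n \<Longrightarrow> e \<in> E0 \<Longrightarrow>
      normalizes (s (Suc (Suc l)) + e + s (Suc (Suc l))) (J (Suc l)) \<and>
      normalizes (s (Suc (Suc l)) + e + s (Suc (Suc l))) K \<and>
      normalizes (s (Suc (Suc l)) + e + s (Suc (Suc l))) E0"
    and act_zero: "act 0 = id" and act_add: "\<And>v w. act (v + w) = act v \<circ> act w"
    and c_nonneg: "0 \<le> c"
    and act_fix: "\<And>m t. l < m \<Longrightarrow> m \<le> n \<Longrightarrow> t \<in> J (m - 1) \<Longrightarrow> act t (int m + c) = int m + c"
    and act_s: "\<And>m. Suc l < m \<Longrightarrow> m \<le> n \<Longrightarrow> act (s m) (int m + c) = int m - 1 + c"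
    and act_s_neg: "\<And>m. Suc l < m \<Longrightarrow> m \<le> n \<Longrightarrow> act (s m) (- (int m - 1 + c)) = - (int m + c)"
    and act_base_inj: "inj_on (\<lambda>d. act d (int (Suc l) + c)) (insert 0 (K \<union> E0))"
    and act_base_bound: "\<And>d. d \<in> K \<Longrightarrow> \<bar>act d (int (Suc l) + c)\<bar> \<le> int (Suc l) + c"
    and act_base_E: "\<And>e. e \<in> E0 \<Longrightarrow> act e (int (Suc l) + c) = - (int (Suc l) + c)"
begin

text \<open>
  \<open>D m\<close> consists of the minimal representatives of the cosets of \<open>W\<^bsub>m-1\<^esub>\<close> in \<open>W\<^sub>m\<close>, for \<open>m > l\<close>;
  the values at \<open>m \<le> l\<close> are irrelevant.  In types B and D the set \<open>E m\<close> holds the longest of them,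
  which sends the point \<open>m\<close> to \<open>-m\<close>.
\<close>

primrec E :: "nat \<Rightarrow> 'w set" where
  "E 0 = E0"
| "E (Suc m) = (if l < m then (\<lambda>e. s (Suc m) + e + s (Suc m)) ` E m else E0)"

primrec D :: "nat \<Rightarrow> 'w set" where
  "D 0 = insert 0 (K \<union> E0)"
| "D (Suc m) = (if l < m then insert 0 ((\<lambda>d. d + s (Suc m)) ` D m \<union> E (Suc m)) else insert 0 (K \<union> E0))"

declare E.simps [simp del] D.simps [simp del]

section \<open>Elementary facts about the chain and its representatives\<close>

lemma E_base: "E (Suc l) = E0" by (simp add: E.simps)
lemma D_base: "D (Suc l) = insert 0 (K \<union> E0)" by (simp add: D.simps)
lemma E_Suc: "l < m \<Longrightarrow> E (Suc m) = (\<lambda>e. s (Suc m) + e + s (Suc m)) ` E m" by (simp add: E.simps)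
lemma D_Suc: "l < m \<Longrightarrow> D (Suc m) = insert 0 ((\<lambda>d. d + s (Suc m)) ` D m \<union> E (Suc m))"
  by (simp add: D.simps)

lemma zero_in_D: "0 \<in> D m"
  by (cases m) (simp_all add: D.simps)

lemma finite_E: "finite (E m)"
  by (induction m) (simp_all add: E.simps finite_base)

lemma finite_D: "finite (D m)"
  by (induction m) (simp_all add: D.simps finite_base finite_E)

lemma J_Suc_sub: "l \<le> m \<Longrightarrow> m < n \<Longrightarrow> J m \<subseteq> J (Suc m)"
  by (metis J_Suc J_bot empty_subsetI le_neq_implies_less subset_insertI)

lemma J_mono:
  assumes "l \<le> i" "i \<le> j" "j \<le> n"
  shows "J i \<subseteq> J j"
  using assms(2,3)
proof (induction j rule: dec_induct)
  case (step k)
  then show ?case using J_Suc_sub[of k] assms(1) by auto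
qed simp

lemma J_sub_S: "l \<le> j \<Longrightarrow> j \<le> n \<Longrightarrow> J j \<subseteq> S"
  using J_mono[of j n] J_top by simp

lemma s_in_J:
  assumes "l < i" "i \<le> j" "j \<le> n"
  shows "s i \<in> J j"
proof -
  obtain k where k: "i = Suc k" using assms(1) by (cases i) auto
  have "s i \<in> J i"
  proof (cases "k = l")
    case False
    then show ?thesis using assms J_Suc[of k] k by simp
  qed (use k s_in_K in simp)
  then show ?thesis using J_mono[of i j] assms by auto
qed

lemma s_in_S: "l < i \<Longrightarrow> i \<le> n \<Longrightarrow> s i \<in> S"
  using s_in_J[of i n] J_top by simp

lemma s_involution: "l < i \<Longrightarrow> i \<le> n \<Longrightarrow> s i + s i = 0"
  by (simp add: s_in_S involution)

lemma s_involution_left: "l < i \<Longrightarrow> i \<le> n \<Longrightarrow> s i + (s i + w) = w"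
  by (simp add: s_involution flip: add.assoc)

lemma s_commute_gen:
  assumes "l < m" "m < n" "w \<in> gen (J (m - 1))"
  shows "s (Suc m) + w = w + s (Suc m)"
  using assms(3) by (rule gen_commute) (rule s_commute[OF assms(1,2)])

lemma E_in_gen:
  assumes "l < m" "m \<le> n"
  shows "E m \<subseteq> gen (J m)"
proof -
  have "Suc l \<le> m" using assms(1) by simp
  then show ?thesis
    using assms(2)
  proof (induction m rule: dec_induct)
    case (step k)
    then have "E k \<subseteq> gen (J (Suc k))"
      using gen_mono[OF J_Suc_sub[of k]] by auto
    moreover have "s (Suc k) \<in> gen (J (Suc k))"
      using step by (intro gen_incl s_in_J) auto
    ultimately show ?case using step by (auto simp: E_Suc intro!: gen_add)
  qed (simp add: E_base E0_sub)
qed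

lemma D_in_gen:
  assumes "l < m" "m \<le> n"
  shows "D m \<subseteq> gen (J m)"
proof -
  have "Suc l \<le> m" using assms(1) by simp
  then show ?thesis
    using assms(2)
  proof (induction m rule: dec_induct)
    case (step k)
    then have "D k \<subseteq> gen (J (Suc k))"
      using gen_mono[OF J_Suc_sub[of k]] by auto
    moreover have "s (Suc k) \<in> gen (J (Suc k))"
      using step by (intro gen_incl s_in_J) auto
    ultimately show ?case using step E_in_gen[of "Suc k"] by (auto simp: D_Suc gen_zero intro!: gen_add)
  qed (use K_sub E0_sub in \<open>auto simp: D_base gen_zero gen_incl\<close>)
qed

section \<open>The elements of \<open>E m\<close>: squares, commutation, normalization\<close>

lemma E_involution:
  assumes "m \<le> n" "e \<in> E m"
  shows "e + e = 0"
  using assms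
proof (induction m arbitrary: e)
  case (Suc m)
  show ?case
  proof (cases "l < m")
    case True
    then obtain e' where e': "e' \<in> E m" "e = s (Suc m) + e' + s (Suc m)"
      using Suc.prems by (auto simp: E_Suc)
    then have "e' + (e' + w) = w" for w using Suc by (simp flip: add.assoc)
    then show ?thesis using e' True Suc.prems by (simp add: add.assoc s_involution_left s_involution)
  qed (use Suc E0_involution in \<open>auto simp: E.simps\<close>)
qed (use E0_involution in \<open>auto simp: E.simps\<close>)

lemma E_cases: "E m = {} \<or> (\<exists>e. E m = {e})"
  by (induction m) (use E0_cases in \<open>auto simp: E.simps\<close>)

lemma s_E: "l < m \<Longrightarrow> m < n \<Longrightarrow> e \<in> E (Suc m) \<Longrightarrow> \<exists>e'\<in>E m. e = s (Suc m) + e' + s (Suc m)"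
  by (auto simp: E_Suc)

text \<open>In signed permutations \<open>e\<close> negates the point \<open>m\<close>, and in type
  D also the point 1, whereas \<open>s i\<close> exchanges two other points or, in type D, points
  from 2 to \<open>m - 1\<close>. The proof itself uses only commutation and braid
  relations.\<close>

lemma E_commute_s:
  assumes "l < m" "m \<le> n" "e \<in> E m" "Suc l < i" "i < m"
  shows "e + s i = s i + e"
proof -
  have "Suc l \<le> m" using assms(1) by simp
  then show ?thesis
    using assms(2-)
  proof (induction m arbitrary: e rule: dec_induct)
    case (step k)
    obtain e' where e': "e' \<in> E k" "e = s (Suc k) + e' + s (Suc k)"
      using s_E[of k e] step by auto
    show ?case
    proof (cases "i < k")
      case True
      then have c: "s (Suc k) + s i = s i + s (Suc k)"
        using step.hyps step.prems by (intro s_commute s_in_J) auto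
      then have c': "s (Suc k) + (s i + w) = s i + (s (Suc k) + w)" for w
        by (simp flip: add.assoc)
      have "e' + s i = s i + e'" using step.IH[of e'] step.prems True e' by auto
      then have "e' + (s i + w) = s i + (e' + w)" for w
        by (simp flip: add.assoc)
      then show ?thesis using e' c c' by (simp add: add.assoc)
    next
      case False
      \<comment> \<open>Here \<open>s i\<close> does not commute with \<open>s (Suc k)\<close>, so
        the recursion is unfolded once more; the core \<open>f\<close> lies low enough to commute
        with \<open>s (Suc k)\<close>, and two braid moves carry \<open>s k\<close> across.\<close>
      then obtain k' where k: "i = k" "k = Suc k'" "l < k'" 
        using step.prems step.hyps by (cases k) auto
      then obtain f where f: "f \<in> E k'" "e' = s k + f + s k"
        using s_E[of k' e'] step.prems e' by auto
      have "f \<in> gen (J k')" using E_in_gen[of k'] f(1) k step.prems by auto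
      then have c: "s (Suc k) + f = f + s (Suc k)"
        using k step.prems step.hyps by (intro s_commute_gen) auto
      then have c': "s (Suc k) + (f + w) = f + (s (Suc k) + w)" for w
        by (simp flip: add.assoc)
      have b: "s k + (s (Suc k) + s k) = s (Suc k) + (s k + s (Suc k))"
        using s_braid[of k] k step.prems by (simp add: add.assoc)
      then have b': "s k + (s (Suc k) + (s k + w)) = s (Suc k) + (s k + (s (Suc k) + w))" for w
        by (metis add.assoc)
      have "e + s k = s (Suc k) + (s k + (f + (s k + (s (Suc k) + s k))))"
        by (simp add: e' f add.assoc)
      also have "\<dots> = s (Suc k) + (s k + (s (Suc k) + (f + (s k + s (Suc k)))))"
        by (simp only: b c')
      also have "\<dots> = s k + e"
        by (simp add: e' f add.assoc b')
      finally show ?thesis using k by simp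
    qed
  qed simp
qed

text \<open>Only the first conjugation, by \<open>s (Suc (Suc l))\<close>, interacts with the base;
  all later generators commute with \<open>gen (J (Suc l))\<close>.\<close>

lemma E_normalizes_base:
  assumes "Suc l < m" "m \<le> n" "e \<in> E m"
  shows "normalizes e (J (Suc l)) \<and> normalizes e K \<and> normalizes e E0"
proof -
  have "Suc (Suc l) \<le> m" using assms(1) by simp
  then show ?thesis
    using assms(2-)
  proof (induction m arbitrary: e rule: dec_induct)
    case base
    then show ?case using base_normalizes s_E[of "Suc l" e] by (auto simp: E_base)
  next
    case (step k)
    obtain e' where e': "e' \<in> E k" "e = s (Suc k) + e' + s (Suc k)"
      using s_E[of k e] step by auto
    have "J (Suc l) \<subseteq> J (k - 1)"
      using step.prems step.hyps by (intro J_mono) auto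
    then have c: "s (Suc k) + w = w + s (Suc k)" if "w \<in> gen (J (Suc l))" for w
      using that step.prems step.hyps gen_mono[of "J (Suc l)" "J (k - 1)"]
      by (intro s_commute_gen) auto
    have "normalizes e' (J (Suc l)) \<and> normalizes e' K \<and> normalizes e' E0"
      using step e' by auto
    then show ?case
      unfolding e'(2) using c E0_sub K_sub gen_incl[of _ "J (Suc l)"] by (blast intro!: normalizes_conj)
  qed
qed

text \<open>Above the base, the three sets are built with generators \<open>s (Suc k)\<close> that
  commute with \<open>e\<close>, so normalization propagates upwards from \<open>J (Suc l)\<close>,
  \<open>K\<close> and \<open>E0\<close>.\<close>

lemma E_normalizes:
  assumes "l < j" "j < m" "m \<le> n" "e \<in> E m"
  shows "normalizes e (J j) \<and> normalizes e (D j) \<and> normalizes e (E j)"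
proof -
  have b: "normalizes e (J (Suc l)) \<and> normalizes e K \<and> normalizes e E0"
    using assms by (intro E_normalizes_base) auto
  have z: "normalizes e {0}"
    by (rule normalizes_commuting) simp
  have "Suc l \<le> j" using assms(1) by simp
  then show ?thesis
    using assms(2)
  proof (induction j rule: dec_induct)
    case base
    show ?case using b z normalizes_Un[of e "{0}" "K \<union> E0"] by (simp add: E_base D_base normalizes_Un)
  next
    case (step k)
    have c: "e + s (Suc k) = s (Suc k) + e"
      using step assms by (intro E_commute_s) auto
    have n: "normalizes e (J k)" "normalizes e (D k)" "normalizes e (E k)"
      using step by auto
    have J: "J (Suc k) = {s (Suc k)} \<union> J k"
      using J_Suc[of k] step assms by simp
    have E: "E (Suc k) = (\<lambda>x. x + s (Suc k)) ` (\<lambda>x. s (Suc k) + x) ` E k"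
      using step by (simp add: E_Suc image_image)
    have nE: "normalizes e (E (Suc k))"
      unfolding E using n c by (intro normalizes_translate normalizes_translate_left)
    have D: "D (Suc k) = {0} \<union> ((\<lambda>x. x + s (Suc k)) ` D k \<union> E (Suc k))"
      using step by (simp add: D_Suc)
    have "normalizes e (D (Suc k))"
      unfolding D using n c nE z by (intro normalizes_translate normalizes_Un) auto
    moreover have "normalizes e (J (Suc k))"
      unfolding J using n c by (intro normalizes_Un) (auto intro: normalizes_commuting)
    ultimately show ?case using nE by simp
  qed
qed

text \<open>This is Deodhar's lemma for the cosets of \<open>W\<^sub>m\<close> modulo the previous
  group of the chain. Both the coset decomposition and the additivity of lengths rest on it.\<close>

lemma D_left_mult:
  assumes "l < m" "m \<le> n" "t \<in> J m" "d \<in> D m"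
  shows "t + d \<in> D m \<or> (\<exists>t'\<in>J (m - 1). t + d = d + t')"
proof -
  have "Suc l \<le> m" using assms(1) by simp
  then show ?thesis
    using assms(2-)
  proof (induction m arbitrary: t d rule: dec_induct)
    case base
    then show ?case using base_closed by (auto simp: D_base)
  next
    case (step m)
    let ?s = "s (Suc m)"
    have m: "l < m" "m < n" "Suc l \<le> m" using step by auto
    have D: "D (Suc m) = insert 0 ((\<lambda>d. d + ?s) ` D m \<union> E (Suc m))"
      using m by (simp add: D_Suc)
    have ss: "?s + ?s = 0" "\<And>w. ?s + (?s + w) = w"
      using m by (auto intro: s_involution s_involution_left)
    have sD: "?s \<in> D (Suc m)" using D zero_in_D[of m] by force
    consider "t = ?s" | "t \<in> J m" using step J_Suc[of m] m by auto
    then show ?case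
    proof cases
      case 1
      consider "d = 0" | d' where "d = d' + ?s" "d' \<in> D m" | "d \<in> E (Suc m)"
        using step.prems D by auto
      then show ?thesis
      proof cases
        case 1
        with sD \<open>t = ?s\<close> show ?thesis by simp
      next
        case 2
        \<comment> \<open>Any other \<open>d'\<close> ends in a letter \<open>k\<close> that braids
          with \<open>s (Suc m)\<close>, after a prefix \<open>u\<close> commuting with
          \<open>s (Suc m)\<close>. A braid move then carries \<open>s (Suc m)\<close> through
          \<open>d\<close>, and it emerges on the right as \<open>k\<close>.\<close>
        consider "d' = 0" | "d' \<in> E m"
          | u k where "d' = u + k" "k \<in> J m" "k + ?s + k = ?s + k + ?s" "?s + u = u + ?s"
        proof (cases "m = Suc l")
          case True
          then show ?thesis using 2 K_braid K_sub that(3)[of 0 d'] that(1,2) m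
            by (auto simp: D_base E_base)
        next
          case False
          then obtain m' where m': "m = Suc m'" "l < m'" using m by (cases m) auto
          have "?s + u = u + ?s" if "u \<in> D m'" for u
            using that D_in_gen[of m'] m' m by (intro s_commute_gen) auto
          then show ?thesis
            using 2 m' m that s_in_J[of m m] s_braid[of m] by (auto simp: D_Suc)
        qed
        then show ?thesis
        proof cases
          case 1
          then show ?thesis using \<open>t = ?s\<close> 2 ss D by simp
        next
          case 2
          then show ?thesis using \<open>t = ?s\<close> \<open>d = d' + ?s\<close> D E_Suc[of m] m by (simp add: add.assoc[symmetric])
        next
          case 3
          have "t + d = (?s + u) + k + ?s" by (simp add: \<open>t = ?s\<close> 2 3(1) add.assoc)
          also have "\<dots> = u + (?s + k + ?s)" using 3 by (simp add: add.assoc)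
          also have "\<dots> = u + (k + ?s + k)" using 3 by simp
          also have "\<dots> = d + k" by (simp add: 2 3(1) add.assoc)
          finally show ?thesis using 3 by auto
        qed
      next
        case 3
        then obtain e where e: "e \<in> E m" "d = ?s + e + ?s" using s_E[of m d] m by auto
        have "e \<in> D m"
        proof (cases "m = Suc l")
          case False
          then obtain m' where m': "m = Suc m'" "l < m'" using m by (cases m) auto
          then show ?thesis using e by (simp add: D_Suc)
        qed (use e in \<open>simp add: D_base E_base\<close>)
        then show ?thesis using e D ss \<open>t = ?s\<close> by (simp add: add.assoc)
      qed
    next
      case 2
      consider "d = 0" | d' where "d = d' + ?s" "d' \<in> D m" | "d \<in> E (Suc m)"
        using step.prems D by auto
      then show ?thesis
      proof cases
        case 1
        with 2 show ?thesis by auto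
      next
        case d: 2
        from step.IH[OF _ 2 d(2)] m
        consider "t + d' \<in> D m" | t' where "t' \<in> J (m - 1)" "t + d' = d' + t'" by auto
        then show ?thesis
        proof cases
          case 1
          then show ?thesis using D d by (simp flip: add.assoc)
        next
          case t': 2
          have "t + d = d + t'" using d t' s_commute[OF m(1,2) t'(1)] by (metis add.assoc)
          moreover have "t' \<in> J m" using t'(1) J_mono[of "m - 1" m] m by (auto simp: Suc_le_eq le_diff_conv2)
          ultimately show ?thesis by auto
        qed
      next
        case 3
        \<comment> \<open>The top element need not commute with \<open>t\<close>; conjugation by it
          permutes \<open>J m\<close>, so some generator appears on the right.\<close>
        then have "normalizes d (J m)" using E_normalizes[of m "Suc m" d] m by auto
        then have "t + d \<in> (\<lambda>x. d + x) ` J m" using 2 by (simp add: normalizes_def)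
        then show ?thesis by auto
      qed
    qed
  qed
qed

section \<open>Existence and uniqueness of the coset decomposition\<close>

lemma J_pred_sub: "l < m \<Longrightarrow> m \<le> n \<Longrightarrow> J (m - 1) \<subseteq> J m"
  by (rule J_mono) auto

lemma gen_decomp:
  assumes "l < m" "m \<le> n" "w \<in> gen (J m)"
  obtains d v where "d \<in> D m" "v \<in> gen (J (m - 1))" "w = d + v"
proof -
  have "\<exists>d\<in>D m. \<exists>v\<in>gen (J (m - 1)). w = d + v"
    using assms(3)
  proof (induction rule: gen_induct)
    case zero
    show ?case using zero_in_D gen_zero by force
  next
    case (add t w)
    then obtain d v where d: "d \<in> D m" "v \<in> gen (J (m - 1))" "w = d + v" by auto
    from D_left_mult[OF assms(1,2) add(1) d(1)] show ?case
    proof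
      assume "\<exists>t'\<in>J (m - 1). t + d = d + t'"
      then obtain t' where t': "t' \<in> J (m - 1)" "t + d = d + t'" by auto
      then have "t + w = d + (t' + v)" using d by (metis add.assoc)
      moreover have "t' + v \<in> gen (J (m - 1))" by (rule gen_add[OF gen_incl[OF t'(1)] d(2)])
      ultimately show ?thesis using d by blast
    next
      assume "t + d \<in> D m"
      then show ?thesis using d by (auto simp: add.assoc[symmetric])
    qed
  qed
  then show ?thesis using that by blast
qed

lemma act_gen_fix:
  assumes "l < m" "m \<le> n" "v \<in> gen (J (m - 1))"
  shows "act v (int m + c) = int m + c"
  using assms(3) by (induction rule: gen_induct) (simp_all add: act_zero act_add act_fix[OF assms(1,2)])

lemma act_E:
  assumes "l < m" "m \<le> n" "e \<in> E m"
  shows "act e (int m + c) = - (int m + c)"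
proof -
  have "Suc l \<le> m" using assms(1) by simp
  then show ?thesis
    using assms(2-)
  proof (induction m arbitrary: e rule: dec_induct)
    case base
    then show ?case using act_base_E by (simp add: E_base)
  next
    case (step k)
    obtain e' where e': "e' \<in> E k" "e = s (Suc k) + e' + s (Suc k)"
      using s_E[of k e] step by auto
    then have "act e' (int k + c) = - (int k + c)"
      using step by auto
    then show ?case using e' step act_s[of "Suc k"] act_s_neg[of "Suc k"] by (simp add: act_add)
  qed
qed

text \<open>The elements \<open>d + s (Suc k)\<close> take at the new point the values of
  \<open>D k\<close> at the old one, which are smaller in absolute value, while 0 and the top
  element give the two extreme values. The bound is proved along with injectivity to keep these
  apart.\<close>

lemma act_D:
  assumes "l < m" "m \<le> n"
  shows "inj_on (\<lambda>d. act d (int m + c)) (D m) \<and> (\<forall>d\<in>D m. \<bar>act d (int m + c)\<bar> \<le> int m + c)"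
proof -
  have "Suc l \<le> m" using assms(1) by simp
  then show ?thesis
    using assms(2-)
  proof (induction m rule: dec_induct)
    case base
    then show ?case using act_base_inj act_base_bound act_base_E c_nonneg
      by (auto simp: D_base act_zero)
  next
    case (step k)
    have s: "act (d + s (Suc k)) (int (Suc k) + c) = act d (int k + c)" for d
      using step act_s[of "Suc k"] by (simp add: act_add)
    have e: "act e (int (Suc k) + c) = - (int (Suc k) + c)" if "e \<in> E (Suc k)" for e
      using step that by (intro act_E) auto
    have inj: "inj_on (\<lambda>d. act d (int k + c)) (D k)"
      and bd: "\<And>d. d \<in> D k \<Longrightarrow> \<bar>act d (int k + c)\<bar> \<le> int k + c"
      using step by auto
    have "\<bar>act d (int (Suc k) + c)\<bar> \<le> int (Suc k) + c" if d: "d \<in> D (Suc k)" for d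
    proof -
      consider "d = 0" | d' where "d' \<in> D k" "d = d' + s (Suc k)" | "d \<in> E (Suc k)"
        using d step by (auto simp: D_Suc)
      then show ?thesis
      proof cases
        case 2
        then show ?thesis using s[of d'] bd[of d'] by simp
      qed (use e[of d] c_nonneg in \<open>simp_all add: act_zero\<close>)
    qed
    moreover have "inj_on (\<lambda>d. act d (int (Suc k) + c)) (D (Suc k))"
    proof (rule inj_onI)
      fix d f assume df: "d \<in> D (Suc k)" "f \<in> D (Suc k)"
        and eq: "act d (int (Suc k) + c) = act f (int (Suc k) + c)"
      have E1: "x = y" if "x \<in> E (Suc k)" "y \<in> E (Suc k)" for x y
        using that E_cases[of "Suc k"] by auto
      consider "d = 0" | d' where "d' \<in> D k" "d = d' + s (Suc k)" | "d \<in> E (Suc k)"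
        using df step by (auto simp: D_Suc)
      note d_cases = this
      consider "f = 0" | f' where "f' \<in> D k" "f = f' + s (Suc k)" | "f \<in> E (Suc k)"
        using df step by (auto simp: D_Suc)
      note f_cases = this
      have 0: "act 0 (int (Suc k) + c) = int (Suc k) + c" by (simp add: act_zero)
      have sb: "\<bar>act (d' + s (Suc k)) (int (Suc k) + c)\<bar> < int (Suc k) + c" if "d' \<in> D k" for d'
        using bd[OF that] s[of d'] by simp
      show "d = f"
        using d_cases
      proof cases
        case 1
        from f_cases show ?thesis
        proof cases
          case f: 2
          then show ?thesis using 1 eq 0 sb[of f'] by auto
        qed (use 1 eq 0 c_nonneg e in auto)
      next
        case 2
        from f_cases show ?thesis
        proof cases
          case f: 2
          then show ?thesis using 2 eq s inj by (auto dest: inj_onD)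
        qed (use 2 eq 0 c_nonneg e sb[of d'] in auto)
      next
        case 3
        from f_cases show ?thesis
        proof cases
          case f: 2
          then show ?thesis using 3 eq e[of d] sb[of f'] by auto
        qed (use 3 eq 0 c_nonneg e E1 in auto)
      qed
    qed
    ultimately show ?case by blast
  qed
qed

text \<open>The factor from \<open>gen (J (m - 1))\<close> fixes the point \<open>m + c\<close>, so
  the image of that point depends on the representative alone.\<close>

lemma decomp_unique:
  assumes "l < m" "m \<le> n" "d \<in> D m" "d' \<in> D m" "v \<in> gen (J (m - 1))" "v' \<in> gen (J (m - 1))"
    and "d + v = d' + v'"
  shows "d = d' \<and> v = v'"
proof -
  have "act (d + v) (int m + c) = act (d' + v') (int m + c)"
    using assms(7) by simp
  then have "act d (int m + c) = act d' (int m + c)"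
    using act_gen_fix[OF assms(1,2)] assms(5,6) by (simp add: act_add)
  then have "d = d'"
    using act_D[OF assms(1,2)] assms(3,4) by (auto dest: inj_onD)
  then show ?thesis using assms(7) by simp
qed

text \<open>
  The right-hand side, read as a function of \<open>d + v\<close>, grows by at most one under left multiplication
  by a generator; this is what bounds the length from below.
\<close>

lemma cox_length_decomp:
  assumes "l < m" "m \<le> n" "d \<in> D m" "v \<in> gen (J (m - 1))"
  shows "cox_length (J m) (d + v) = cox_length (J m) d + cox_length (J (m - 1)) v"
proof (rule antisym)
  have sub: "gen (J (m - 1)) \<subseteq> gen (J m)" "D m \<subseteq> gen (J m)"
    using gen_mono J_pred_sub D_in_gen assms by auto
  show "cox_length (J m) (d + v) \<le> cox_length (J m) d + cox_length (J (m - 1)) v"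
  proof -
    have "cox_length (J m) (d + v) \<le> cox_length (J m) d + cox_length (J m) v"
      using sub assms by (intro cox_length_add_le) auto
    then show ?thesis
      using cox_length_mono[OF J_pred_sub[OF assms(1,2)] assms(4)] by linarith
  qed
  \<comment> \<open>\<open>dec\<close> recovers the two factors from the product; \<open>THE\<close>
    is justified by \<open>decomp_unique\<close>.\<close>
  define dec where "dec w = (THE x. fst x \<in> D m \<and> snd x \<in> gen (J (m - 1)) \<and> w = fst x + snd x)" for w
  have dec: "dec (d + v) = (d, v)" if "d \<in> D m" "v \<in> gen (J (m - 1))" for d v
    unfolding dec_def using that decomp_unique[OF assms(1,2)]
    by (intro the_equality) (auto simp: prod_eq_iff)
  define f where "f w = cox_length (J m) (fst (dec w)) + cox_length (J (m - 1)) (snd (dec w))" for w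
  have "f (d + v) \<le> cox_length (J m) (d + v)"
  proof (rule le_cox_length)
    show "d + v \<in> gen (J m)" using assms sub by (intro gen_add) auto
    show "f 0 = 0" using dec[of 0 0] by (simp add: f_def zero_in_D gen_zero cox_length_zero)
    fix t w assume t: "t \<in> J m" and w: "w \<in> gen (J m)"
    from w obtain d v where dv: "d \<in> D m" "v \<in> gen (J (m - 1))" "w = d + v"
      by (rule gen_decomp[OF assms(1,2)])
    from D_left_mult[OF assms(1,2) t dv(1)] show "f (t + w) \<le> Suc (f w)"
    proof
      assume td: "t + d \<in> D m"
      have "cox_length (J m) (t + d) \<le> cox_length (J m) t + cox_length (J m) d"
        using cox_length_add_le[OF gen_incl[OF t]] dv(1) sub by auto
      also have "\<dots> \<le> Suc (cox_length (J m) d)"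
        using cox_length_gen_le[OF t] by simp
      finally show ?thesis
        using dec[OF td dv(2)] dec[OF dv(1,2)] dv(3) by (simp add: f_def add.assoc)
    next
      assume "\<exists>t'\<in>J (m - 1). t + d = d + t'"
      then obtain t' where t': "t' \<in> J (m - 1)" "t + d = d + t'" by auto
      have v': "t' + v \<in> gen (J (m - 1))" by (rule gen_add[OF gen_incl[OF t'(1)] dv(2)])
      have "cox_length (J (m - 1)) (t' + v) \<le> cox_length (J (m - 1)) t' + cox_length (J (m - 1)) v"
        by (rule cox_length_add_le[OF gen_incl[OF t'(1)] dv(2)])
      also have "\<dots> \<le> Suc (cox_length (J (m - 1)) v)"
        using cox_length_gen_le[OF t'(1)] by simp
      finally show ?thesis
        using dec[OF dv(1) v'] dec[OF dv(1,2)] dv(3) t'(2) by (simp add: f_def flip: add.assoc)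
    qed
  qed
  then show "cox_length (J m) d + cox_length (J (m - 1)) v \<le> cox_length (J m) (d + v)"
    using dec[OF assms(3,4)] by (simp add: f_def)
qed

text \<open>\<open>Y j m\<close> is \<open>D m + \<dots> + D (Suc j)\<close>, and \<open>{0}\<close> for \<open>m \<le> j\<close>.\<close>

primrec Y :: "nat \<Rightarrow> nat \<Rightarrow> 'w set" where
  "Y j 0 = {0}"
| "Y j (Suc m) = (if j \<le> m then {d + u | d u. d \<in> D (Suc m) \<and> u \<in> Y j m} else {0})"

section \<open>Minimal representatives of the left cosets of \<open>W\<^sub>j\<close>\<close>

lemma Y_self: "Y j j = {0}"
  by (cases j) simp_all

lemma Y_Suc: "j \<le> m \<Longrightarrow> Y j (Suc m) = {d + u | d u. d \<in> D (Suc m) \<and> u \<in> Y j m}"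
  by simp

declare Y.simps [simp del]

lemma Y_in_gen:
  assumes "j \<le> m" "l \<le> j" "m \<le> n"
  shows "Y j m \<subseteq> gen (J m)"
  using assms
proof (induction m rule: dec_induct)
  case (step k)
  then have "Y j k \<subseteq> gen (J (Suc k))" using gen_mono[OF J_Suc_sub[of k]] by auto
  then show ?case using step D_in_gen[of "Suc k"] by (auto simp: Y_Suc intro!: gen_add)
qed (simp add: Y_self gen_zero)

lemma Y_decomp:
  assumes "j \<le> m" "l \<le> j" "m \<le> n" "w \<in> gen (J m)"
  shows "\<exists>u\<in>Y j m. \<exists>v\<in>gen (J j). w = u + v"
  using assms
proof (induction m arbitrary: w rule: dec_induct)
  case (step k)
  obtain d v where d: "d \<in> D (Suc k)" "v \<in> gen (J k)" "w = d + v"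
    using gen_decomp[of "Suc k" w] step by auto
  then obtain u v' where "u \<in> Y j k" "v' \<in> gen (J j)" "v = u + v'"
    using step by force
  moreover from this have "d + u \<in> Y j (Suc k)" using step d by (auto simp: Y_Suc)
  ultimately show ?case using d by (metis add.assoc)
qed (simp add: Y_self)

lemma cox_length_Y:
  assumes "j \<le> m" "l \<le> j" "m \<le> n" "u \<in> Y j m" "v \<in> gen (J j)"
  shows "cox_length (J m) (u + v) = cox_length (J m) u + cox_length (J j) v"
  using assms
proof (induction m arbitrary: u rule: dec_induct)
  case (step k)
  then obtain d u' where d: "d \<in> D (Suc k)" "u' \<in> Y j k" "u = d + u'"
    by (auto simp: Y_Suc)
  have u': "u' \<in> gen (J k)" using d Y_in_gen[of j k] step by auto
  have v: "v \<in> gen (J k)" using gen_mono[OF J_mono[of j k]] step by auto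
  have "cox_length (J (Suc k)) (d + (u' + v)) = cox_length (J (Suc k)) d + cox_length (J k) (u' + v)"
    using cox_length_decomp[of "Suc k" d "u' + v"] gen_add[OF u' v] d step by simp
  also have "cox_length (J k) (u' + v) = cox_length (J k) u' + cox_length (J j) v"
    using step d by auto
  also have "cox_length (J (Suc k)) u = cox_length (J (Suc k)) d + cox_length (J k) u'"
    using cox_length_decomp[of "Suc k" d "u'"] u' d step by simp
  ultimately show ?case
    using d by (simp add: add.assoc)
qed (simp add: Y_self cox_length_zero)

text \<open>Lengths add in \<open>u + v\<close>. So every generator in \<open>J j\<close> lengthens
  an element of \<open>Y j n\<close>, whereas an element with \<open>v \<noteq> 0\<close> is
  shortened by the last letter of a reduced word of \<open>v\<close>.\<close>

lemma X_set_eq: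
  assumes "l \<le> j" "j \<le> n"
  shows "X_set S (J j) = Y j n"
proof (rule set_eqI)
  fix w
  obtain u v where uv: "u \<in> Y j n" "v \<in> gen (J j)" "w = u + v"
    using Y_decomp[of j n w] assms gen_S J_top by auto
  have len: "cox_length S (u + v) = cox_length S u + cox_length (J j) v" if "v \<in> gen (J j)" "u \<in> Y j n" for u v
    using cox_length_Y[of j n u v] that assms J_top by simp
  show "w \<in> X_set S (J j) \<longleftrightarrow> w \<in> Y j n"
  proof
    assume w: "w \<in> Y j n"
    have "cox_length S w < cox_length S (w + t)" if "t \<in> J j" for t
    proof -
      have "t \<noteq> 0" using that J_sub_S[of j] assms nontrivial by auto
      then show ?thesis using len[of t w] w that cox_length_pos[of t "J j"] gen_incl[of t "J j"] by simp
    qed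
    then show "w \<in> X_set S (J j)" by (simp add: X_set_def)
  next
    assume w: "w \<in> X_set S (J j)"
    have "v = 0"
    proof (rule ccontr)
      assume "v \<noteq> 0"
      obtain us where us: "us \<in> lists (J j)" "length us = cox_length (J j) v" "sum_list us = v"
        using uv(2) by (rule cox_length_word)
      with \<open>v \<noteq> 0\<close> obtain vs t where vs: "us = vs @ [t]" by (cases us rule: rev_cases) auto
      then have t: "t \<in> J j" "vs \<in> lists (J j)" using us by auto
      then have "t \<in> S" using J_sub_S[of j] assms by auto
      then have "v + t = sum_list vs" using us vs involution[of t] by (auto simp: add.assoc)
      then have "w + t = u + sum_list vs" using uv by (simp add: add.assoc)
      moreover have "sum_list vs \<in> gen (J j)" using t by (auto simp: gen_def)
      ultimately have "cox_length S (w + t) < cox_length S w"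
        using len[of v u] len[of "sum_list vs" u] uv us vs cox_length_le[OF t(2)] by simp
      then show False using w t(1) by (auto simp: X_set_def)
    qed
    then show "w \<in> Y j n" using uv by simp
  qed
qed

lemma finite_Y: "finite (Y j m)"
proof (induction m)
  case (Suc m)
  have "{d + u |d u. d \<in> D (Suc m) \<and> u \<in> Y j m} = (\<lambda>(d, u). d + u) ` (D (Suc m) \<times> Y j m)"
    by auto
  then show ?case using Suc finite_D by (simp add: Y.simps)
qed (simp add: Y.simps)

lemma group_sum_Y_Suc:
  assumes "l \<le> j" "j \<le> m" "m < n"
  shows "group_sum (Y j (Suc m)) = group_sum (D (Suc m)) * group_sum (Y j m)"
proof -
  have "inj_on (\<lambda>(a, b). a + b) (D (Suc m) \<times> Y j m)"
  proof (rule inj_onI, clarify)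
    fix a b a' b' assume "a \<in> D (Suc m)" "b \<in> Y j m" "a' \<in> D (Suc m)" "b' \<in> Y j m" "a + b = a' + b'"
    then show "a = a' \<and> b = b'"
      using decomp_unique[of "Suc m" a a' b b'] Y_in_gen[of j m] assms by auto
  qed
  then show ?thesis using assms by (simp add: Y_Suc group_sum_set_add)
qed

section \<open>Products of the coset sums\<close>

abbreviation d_sum :: "nat \<Rightarrow> 'w \<Rightarrow>\<^sub>0 rat" where "d_sum m \<equiv> group_sum (D m)"

abbreviation s_elt :: "nat \<Rightarrow> 'w \<Rightarrow>\<^sub>0 rat" where "s_elt m \<equiv> elt (s m)"

lemma s_elt_square: "l < m \<Longrightarrow> m \<le> n \<Longrightarrow> s_elt m * s_elt m = 1"
  by (simp add: elt_mult s_involution)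

lemma group_sum_zero: "group_sum {0} = 1"
  by (simp add: group_sum_def)

lemma d_sum_base: "d_sum (Suc l) = 1 + group_sum K + group_sum (E (Suc l))"
proof -
  have "D (Suc l) = {0} \<union> (K \<union> E0)" by (simp add: D_base)
  then show ?thesis
    using base_disjoint finite_base
    by (simp add: group_sum_Un group_sum_zero E_base add.assoc del: Un_insert_left)
qed

text \<open>The three parts are disjoint by their effect on the point \<open>Suc m + c\<close>: it
  is fixed, sent to a point of smaller absolute value, or negated.\<close>

lemma d_sum_Suc:
  assumes "l < m" "m < n"
  shows "d_sum (Suc m) = 1 + d_sum m * s_elt (Suc m) + group_sum (E (Suc m))"
proof -
  let ?T = "(\<lambda>d. d + s (Suc m)) ` D m"
  have D: "D (Suc m) = {0} \<union> (?T \<union> E (Suc m))" using assms by (simp add: D_Suc)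
  have E: "act e (int (Suc m) + c) = - (int (Suc m) + c)" if "e \<in> E (Suc m)" for e
    using assms that by (intro act_E) auto
  have T: "\<bar>act d (int (Suc m) + c)\<bar> < int (Suc m) + c" if "d \<in> ?T" for d
    using that assms act_D[of m] act_s[of "Suc m"] by (auto simp: act_add)
  have z: "act 0 (int (Suc m) + c) = int (Suc m) + c" by (simp add: act_zero)
  have "0 \<notin> ?T" using T[of 0] z by auto
  moreover have "0 \<notin> E (Suc m)" using E[of 0] z c_nonneg by auto
  moreover have "?T \<inter> E (Suc m) = {}"
  proof (rule ccontr)
    assume "?T \<inter> E (Suc m) \<noteq> {}"
    then obtain w where "w \<in> ?T" "w \<in> E (Suc m)" by blast
    then show False using T[of w] E[of w] by linarith
  qed
  ultimately show ?thesis
    unfolding D using finite_D finite_E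
    by (simp add: group_sum_Un group_sum_zero group_sum_translate_right add.assoc del: Un_insert_left)
qed

lemma E_sum_Suc:
  assumes "l < m"
  shows "group_sum (E (Suc m)) = s_elt (Suc m) * group_sum (E m) * s_elt (Suc m)"
proof -
  have "E (Suc m) = (\<lambda>x. x + s (Suc m)) ` (\<lambda>x. s (Suc m) + x) ` E m"
    using assms by (simp add: E_Suc image_image)
  then show ?thesis by (simp add: group_sum_translate_left group_sum_translate_right)
qed

text \<open>\<open>D (Suc l)\<close> represents the cosets of the trivial group, so it is closed
  under right multiplication; an injective self-map of a finite set permutes it.\<close>

lemma d_sum_base_absorb:
  assumes "w \<in> gen (J (Suc l))"
  shows "d_sum (Suc l) * elt w = d_sum (Suc l)"
proof -
  have "d + w \<in> D (Suc l)" if "d \<in> D (Suc l)" for d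
    using assms that
  proof (induction arbitrary: d rule: gen_induct)
    case (add t w)
    then have "d + t \<in> D (Suc l)" using base_closed by (simp add: D_base)
    from add.IH[OF this] show ?case by (simp add: add.assoc)
  qed simp
  then have "(\<lambda>d. d + w) ` D (Suc l) \<subseteq> D (Suc l)" by auto
  then have "(\<lambda>d. d + w) ` D (Suc l) = D (Suc l)"
    by (intro endo_inj_surj finite_D) (auto simp: inj_on_def)
  then show ?thesis by (metis group_sum_translate_right)
qed

text \<open>The involution \<open>e\<close> swaps the summands 1 and \<open>e\<close>; in the middle
  summand the inner \<open>s (Suc k)\<close> cancels and \<open>d_sum k\<close> absorbs the smaller
  element \<open>e'\<close>.\<close>

lemma d_sum_E_absorb:
  assumes "l < m" "m \<le> n" "e \<in> E m"
  shows "d_sum m * elt e = d_sum m"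
proof -
  have "Suc l \<le> m" using assms(1) by simp
  then show ?thesis
    using assms(2-)
  proof (induction m arbitrary: e rule: dec_induct)
    case base
    then show ?case using d_sum_base_absorb E0_sub by (auto simp: E_base)
  next
    case (step k)
    let ?s = "s_elt (Suc k)"
    obtain e' where e': "e' \<in> E k" "e = s (Suc k) + e' + s (Suc k)"
      using s_E[of k e] step by auto
    have E: "group_sum (E (Suc k)) = elt e"
      using E_cases[of "Suc k"] step.prems by (auto simp: group_sum_def)
    have IH: "d_sum k * elt e' = d_sum k" using step e' by auto
    have ss: "?s * ?s = 1" using step by (intro s_elt_square) auto
    have e: "elt e = ?s * elt e' * ?s" by (simp add: e' elt_mult)
    have "d_sum k * ?s * elt e = d_sum k * (?s * ?s) * elt e' * ?s"
      by (simp add: e mult.assoc)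
    also have "\<dots> = d_sum k * ?s"
      by (simp add: ss IH)
    finally have "d_sum k * ?s * elt e = d_sum k * ?s" .
    moreover have "elt e * elt e = 1"
      using step.prems E_involution[of "Suc k" e] by (simp add: elt_mult)
    moreover have "d_sum (Suc k) = 1 + d_sum k * ?s + elt e"
      using d_sum_Suc[of k] step E by simp
    ultimately show ?case by (simp add: distrib_right)
  qed
qed

lemma card_E: "card (E m) = card E0"
proof (induction m)
  case (Suc m)
  then show ?case using E_cases[of m] by (auto simp: E.simps)
qed (simp add: E.simps)

lemma d_sum_mult_E:
  assumes "l < m" "m \<le> n"
  shows "d_sum m * group_sum (E m) = of_nat (card E0) * d_sum m"
proof -
  have "d_sum m * group_sum (E m) = (\<Sum>e\<in>E m. d_sum m * elt e)"
    by (simp add: group_sum_def[of "E m"] sum_distrib_left)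
  also have "\<dots> = of_nat (card (E m)) * d_sum m"
    using d_sum_E_absorb[OF assms] by simp
  finally show ?thesis by (simp add: card_E)
qed

lemma E_sum_commute:
  assumes "l < m" "m < n"
  shows "group_sum (E (Suc m)) * d_sum m = d_sum m * group_sum (E (Suc m))"
proof -
  have "elt e * d_sum m = d_sum m * elt e" if "e \<in> E (Suc m)" for e
    using that assms E_normalizes[of m "Suc m" e] by (auto intro: normalizes_group_sum)
  then show ?thesis
    by (simp add: group_sum_def[of "E (Suc m)"] sum_distrib_left sum_distrib_right)
qed

text \<open>
  \<open>d_sum (Suc m) * d_sum m\<close> is the sum of the minimal coset representatives of \<open>W\<^bsub>m-1\<^esub>\<close>
  in \<open>W\<^bsub>m+1\<^esub>\<close>, which right multiplication by \<open>s\<^bsub>m+1\<^esub>\<close> permutes.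
\<close>

lemma d_sum_s_absorb:
  assumes "l < m" "m < n"
  shows "d_sum (Suc m) * d_sum m * s_elt (Suc m) = d_sum (Suc m) * d_sum m"
proof -
  \<comment> \<open>The computation shared by base and step: \<open>A\<close> is the middle part of
    \<open>d_sum m\<close>. Once the product is expanded, right multiplication by \<open>?g\<close>
    swaps \<open>?d\<close> with \<open>?d * ?g\<close>, swaps \<open>?d * ?g * ?e\<close> with
    \<open>?d * ?g * ?e * ?g\<close>, and fixes the term with \<open>A\<close>.\<close>
  have *: "d_sum (Suc m) * d_sum m * s_elt (Suc m) = d_sum (Suc m) * d_sum m"
    if m: "l < m" "m < n" and A: "d_sum m = 1 + A + group_sum (E m)"
      and As: "d_sum m * s_elt (Suc m) * A * s_elt (Suc m) = d_sum m * s_elt (Suc m) * A" for m A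
  proof -
    let ?d = "d_sum m" and ?g = "s_elt (Suc m)" and ?e = "group_sum (E m)"
    have gg: "?g * ?g = 1" "?g * (?g * x) = x" for x
      using m by (simp_all add: s_elt_square flip: mult.assoc)
    have "d_sum (Suc m) * ?d = ?d + ?d * ?g * ?d + group_sum (E (Suc m)) * ?d"
      using m by (simp add: d_sum_Suc distrib_right)
    also have "group_sum (E (Suc m)) * ?d = ?d * ?g * ?e * ?g"
      using m by (simp add: E_sum_commute) (simp add: E_sum_Suc mult.assoc)
    also have "?d * ?g * ?d = ?d * ?g + ?d * ?g * A + ?d * ?g * ?e"
      by (subst (2) A) (simp add: distrib_left)
    finally have 1: "d_sum (Suc m) * ?d
      = ?d + (?d * ?g + ?d * ?g * A + ?d * ?g * ?e) + ?d * ?g * ?e * ?g" .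
    have "?d * ?g * ?g = ?d" "?d * ?g * ?e * ?g * ?g = ?d * ?g * ?e"
      by (simp_all add: mult.assoc gg)
    then show ?thesis
      unfolding 1 distrib_right As by (simp add: algebra_simps)
  qed
  have "Suc l \<le> m" using assms(1) by simp
  then show ?thesis
    using assms(2)
  proof (induction m rule: dec_induct)
    case base
    let ?d = "d_sum (Suc l)" and ?g = "s_elt (Suc (Suc l))"
    have "?d * ?g * elt k * ?g = ?d * ?g * elt k" if "k \<in> K" for k
    proof -
      have dk: "?d * elt k = ?d"
        using that K_sub by (intro d_sum_base_absorb gen_incl) auto
      \<comment> \<open>The braid relation brings a \<open>k\<close> to the front, where
        \<open>?d\<close> absorbs it.\<close>
      have "?d * ?g * elt k * ?g = ?d * elt (k + s (Suc (Suc l)) + k)"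
        using base that by (simp add: mult.assoc elt_mult K_braid add.assoc[symmetric])
      also have "\<dots> = (?d * elt k) * elt (s (Suc (Suc l)) + k)"
        by (simp add: mult.assoc elt_mult add.assoc)
      also have "\<dots> = ?d * ?g * elt k"
        by (simp only: dk) (simp add: mult.assoc elt_mult)
      finally show ?thesis .
    qed
    then show ?case
      using base d_sum_base
      by (intro *[where A = "group_sum K"]) (simp_all add: group_sum_def[of K] sum_distrib_left sum_distrib_right)
  next
    case (step m)
    let ?d = "d_sum (Suc m)" and ?f = "s_elt (Suc m)" and ?g = "s_elt (Suc (Suc m))"
    have m: "l < m" "Suc m < n" using step by auto
    have IH: "?d * d_sum m * ?f = ?d * d_sum m" using step by simp
    have "s (Suc (Suc m)) + w = w + s (Suc (Suc m))" if "w \<in> D m" for w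
      using m that D_in_gen[of m] by (intro s_commute_gen) auto
    then have c: "?g * d_sum m = d_sum m * ?g"
      by (intro normalizes_group_sum normalizes_commuting)
    have b: "?g * ?f * ?g = ?f * ?g * ?f"
      using m s_braid[of "Suc m"] by (simp add: elt_mult)
    \<comment> \<open>After \<open>?g\<close> passes \<open>d_sum m\<close>, a braid move puts
      \<open>?f\<close> in front, where the induction hypothesis absorbs it.\<close>
    have "?d * ?g * (d_sum m * ?f) * ?g = ?d * (?g * d_sum m) * ?f * ?g"
      by (simp add: mult.assoc)
    also have "\<dots> = ?d * d_sum m * (?g * ?f * ?g)"
      by (simp add: c mult.assoc)
    also have "\<dots> = ?d * d_sum m * ?g * ?f"
      by (simp only: b) (simp only: IH mult.assoc[symmetric])
    also have "\<dots> = ?d * (?g * d_sum m) * ?f"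
      by (simp add: c mult.assoc)
    finally have "?d * ?g * (d_sum m * ?f) * ?g = ?d * ?g * (d_sum m * ?f)"
      by (simp add: mult.assoc)
    then show ?case
      using m by (intro *[where A = "d_sum m * ?f"]) (simp_all add: d_sum_Suc)
  qed
qed

text \<open>Expand the right factor: 1 and each element of \<open>E (Suc m)\<close> return
  \<open>d_sum (Suc m)\<close>, which explains the coefficient, and the middle part loses its
  \<open>s (Suc m)\<close>.\<close>

lemma d_sum_square:
  assumes "l < m" "m < n"
  shows "d_sum (Suc m) * d_sum (Suc m)
    = of_nat (Suc (card E0)) * d_sum (Suc m) + d_sum (Suc m) * d_sum m"
proof -
  let ?d = "d_sum (Suc m)"
  have "?d * ?d = ?d * (1 + d_sum m * s_elt (Suc m) + group_sum (E (Suc m)))"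
    using d_sum_Suc[OF assms] by simp
  also have "\<dots> = ?d + ?d * d_sum m * s_elt (Suc m) + ?d * group_sum (E (Suc m))"
    by (simp add: distrib_left mult.assoc)
  also have "\<dots> = ?d + ?d * d_sum m + of_nat (card E0) * ?d"
    using assms by (simp add: d_sum_s_absorb d_sum_mult_E)
  finally show ?thesis by (simp add: algebra_simps)
qed

lemma d_sum_base_square: "d_sum (Suc l) * d_sum (Suc l) = of_nat (card (D (Suc l))) * d_sum (Suc l)"
proof -
  have "d_sum (Suc l) * d_sum (Suc l) = (\<Sum>w\<in>D (Suc l). d_sum (Suc l) * elt w)"
    by (subst (2) group_sum_def) (simp add: sum_distrib_left)
  also have "\<dots> = (\<Sum>w\<in>D (Suc l). d_sum (Suc l))"
    using D_in_gen[of "Suc l"] l_less by (intro sum.cong d_sum_base_absorb) auto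
  finally show ?thesis by simp
qed

lemma mult_of_nat_left_commute: "a * (of_nat k * b) = of_nat k * (a * b)"
  for a b :: "'w \<Rightarrow>\<^sub>0 rat"
  by (metis mult.assoc mult_of_nat_commute)

text \<open>The square relation moves the multiplication one factor down, each of the
  \<open>m - j\<close> levels contributing \<open>Suc (card E0)\<close>. At level \<open>j\<close>
  the factor \<open>d_sum j\<close> survives and extends the product to
  \<open>Y (j - 1)\<close>.\<close>

lemma d_sum_mult_Y:
  assumes "l < j" "j \<le> m" "m \<le> n"
  shows "d_sum m * group_sum (Y j m)
    = of_nat (Suc (card E0) * (m - j)) * group_sum (Y j m) + group_sum (Y (j - 1) m)"
  using assms(2,3)
proof (induction m rule: dec_induct)
  case base
  obtain j' where "j = Suc j'" using assms(1) by (cases j) auto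
  then show ?case
    using group_sum_Y_Suc[of j' j'] assms(1) base by (simp add: Y_self group_sum_zero)
next
  case (step m)
  let ?d = "d_sum (Suc m)" and ?k = "Suc (card E0)"
  let ?y = "\<lambda>j m. group_sum (Y j m)"
  have Y: "?y j (Suc m) = ?d * ?y j m" "?y (j - 1) (Suc m) = ?d * ?y (j - 1) m"
    using step assms by (auto intro!: group_sum_Y_Suc)
  have "?d * ?y j (Suc m) = (?d * ?d) * ?y j m"
    by (simp add: Y mult.assoc)
  also have "\<dots> = of_nat ?k * ?y j (Suc m) + ?d * (d_sum m * ?y j m)"
    using step assms by (simp only: d_sum_square Y distrib_right mult.assoc)
  also have "d_sum m * ?y j m = of_nat (?k * (m - j)) * ?y j m + ?y (j - 1) m"
    using step by simp
  also have "?d * \<dots> = of_nat (?k * (m - j)) * ?y j (Suc m) + ?y (j - 1) (Suc m)"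
    by (simp only: Y distrib_left mult_of_nat_left_commute)
  also have "of_nat ?k * ?y j (Suc m) + \<dots> = of_nat (?k * (Suc m - j)) * ?y j (Suc m) + ?y (j - 1) (Suc m)"
  proof -
    have "?k * (Suc m - j) = ?k + ?k * (m - j)" using step by (simp add: Suc_diff_le)
    then show ?thesis by (simp only: of_nat_add distrib_right add.assoc)
  qed
  finally show ?case .
qed

text \<open>The same descent stops at level \<open>Suc l\<close>, where the sum over a whole group
  is squared and yields its cardinality.\<close>

lemma d_sum_mult_Y_bot:
  assumes "l < m" "m \<le> n"
  shows "d_sum m * group_sum (Y l m)
    = of_nat (Suc (card E0) * (m - Suc l) + card (D (Suc l))) * group_sum (Y l m)"
proof -
  have "Suc l \<le> m" using assms(1) by simp
  then show ?thesis
    using assms(2)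
  proof (induction m rule: dec_induct)
    case base
    then show ?case
      using group_sum_Y_Suc[of l l] d_sum_base_square by (simp add: Y_self group_sum_zero)
  next
    case (step m)
    let ?d = "d_sum (Suc m)" and ?k = "Suc (card E0)" and ?y = "\<lambda>m. group_sum (Y l m)"
    let ?c = "?k * (m - Suc l) + card (D (Suc l))"
    have Y: "?y (Suc m) = ?d * ?y m"
      using step by (auto intro!: group_sum_Y_Suc)
    have "?d * ?y (Suc m) = (?d * ?d) * ?y m"
      by (simp add: Y mult.assoc)
    also have "\<dots> = of_nat ?k * ?y (Suc m) + ?d * (d_sum m * ?y m)"
      using step assms by (simp only: d_sum_square Y distrib_right mult.assoc)
    also have "d_sum m * ?y m = of_nat ?c * ?y m"
      using step by simp
    also have "?d * \<dots> = of_nat ?c * ?y (Suc m)"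
      by (simp only: Y mult_of_nat_left_commute)
    also have "of_nat ?k * ?y (Suc m) + \<dots> = of_nat (?k * (Suc m - Suc l) + card (D (Suc l))) * ?y (Suc m)"
    proof -
      have "Suc m - Suc l = Suc (m - Suc l)" using step by simp
      then show ?thesis by (simp only: mult_Suc_right of_nat_add distrib_right add.assoc)
    qed
    finally show ?case .
  qed
qed

section \<open>The native basis\<close>

abbreviation x :: "nat \<Rightarrow> 'w \<Rightarrow>\<^sub>0 rat" where "x j \<equiv> x_elem S (J j)"

lemma x_eq: "l \<le> j \<Longrightarrow> j \<le> n \<Longrightarrow> x j = group_sum (Y j n)"
  by (simp add: x_elem_def X_set_eq group_sum_def)

lemma x_top: "x n = 1"
  using l_less by (simp add: x_eq Y_self group_sum_zero)

lemma x_pred_top: "x (n - 1) = d_sum n"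
  using l_less group_sum_Y_Suc[of "n - 1" "n - 1"] by (simp add: x_eq Y_self group_sum_zero)

lemma x_mult:
  assumes "l < j" "j \<le> n"
  obtains k where "x (n - 1) * x j = of_nat k * x j + x (j - 1)"
proof -
  have "x (n - 1) * x j = of_nat (Suc (card E0) * (n - j)) * x j + x (j - 1)"
    using assms d_sum_mult_Y[of j n] x_eq[of j] x_eq[of "j - 1"] x_pred_top by simp
  then show ?thesis by (rule that)
qed

lemma x_mult_bot:
  obtains k where "x (n - 1) * x l = of_nat k * x l"
proof -
  have "x (n - 1) * x l = of_nat (Suc (card E0) * (n - Suc l) + card (D (Suc l))) * x l"
    using l_less d_sum_mult_Y_bot[of n] x_eq[of l] x_pred_top by simp
  then show ?thesis by (rule that)
qed

section \<open>Linear independence\<close>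

lemma lookup_x:
  "l \<le> j \<Longrightarrow> j \<le> n \<Longrightarrow> Poly_Mapping.lookup (x j) w = (if w \<in> X_set S (J j) then 1 else 0)"
  by (simp add: x_eq lookup_group_sum X_set_eq finite_Y)

lemma s_notin_X_set:
  assumes "l < i" "i \<le> j" "j \<le> n"
  shows "s i \<notin> X_set S (J j)"
proof
  assume "s i \<in> X_set S (J j)"
  then have "cox_length S (s i) < cox_length S (s i + s i)"
    using s_in_J[OF assms] by (simp add: X_set_def)
  then show False
    using s_involution[of i] assms by (simp add: cox_length_zero)
qed

lemma s_in_X_set:
  assumes "l \<le> j" "j < n"
  shows "s (Suc j) \<in> X_set S (J j)"
proof -
  have "s (Suc j) \<in> D (Suc j)"
  proof (cases "j = l")
    case True
    then show ?thesis using s_in_K by (simp add: D_base)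
  next
    case False
    then show ?thesis using assms zero_in_D[of j] by (force simp: D_Suc)
  qed
  then have base: "s (Suc j) \<in> Y j (Suc j)"
    by (force simp: Y_Suc Y_self)
  have "Suc j \<le> n" using assms by simp
  then have "s (Suc j) \<in> Y j n"
  proof (induction n rule: dec_induct)
    case (step m)
    then show ?case using zero_in_D[of "Suc m"] by (force simp: Y_Suc)
  qed (rule base)
  then show ?thesis using assms by (simp add: X_set_eq)
qed

lemma span_lookup_zero:
  assumes "v \<in> group_algebra.span B" "\<And>b. b \<in> B \<Longrightarrow> Poly_Mapping.lookup b w = 0"
  shows "Poly_Mapping.lookup v w = 0"
  using assms(1)
  by (induction rule: group_algebra.span_induct_alt) (simp_all add: lookup_add lookup_scale assms(2))

text \<open>Downward induction from \<open>x n = 1\<close>: the coefficient at the group element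
  \<open>s (Suc j)\<close> separates \<open>x j\<close> from the span of its successors.\<close>

lemma x_independent:
  assumes "l \<le> j" "j \<le> n"
  shows "group_algebra.independent (x ` {j..n})"
  using assms(2,1)
proof (induction j rule: inc_induct)
  case base
  have "(1 :: 'w \<Rightarrow>\<^sub>0 rat) \<noteq> 0" by simp
  then show ?case by (simp add: x_top)
next
  case (step j)
  have "x j \<notin> group_algebra.span (x ` {Suc j..n})"
  proof
    assume "x j \<in> group_algebra.span (x ` {Suc j..n})"
    then have "Poly_Mapping.lookup (x j) (s (Suc j)) = 0"
      using step.hyps step.prems s_notin_X_set[of "Suc j"]
      by (elim span_lookup_zero) (auto simp: lookup_x)
    then show False
      using step s_in_X_set[of j] by (simp add: lookup_x)
  qed
  moreover have "{j..n} = insert j {Suc j..n}" using step by auto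
  ultimately show ?case
    using step by (simp add: group_algebra.independent_insertI)
qed

text \<open>In the recursion the element of lower index has coefficient 1, so solving for it
  introduces no denominators.\<close>

lemma x_int_poly:
  assumes "l \<le> j" "j \<le> n"
  shows "\<exists>p. x j = int_poly_eval p (x (n - 1))"
  using assms(2,1)
proof (induction j rule: inc_induct)
  case base
  show ?case using int_poly_eval_one x_top by metis
next
  case (step j)
  then obtain p where p: "x (Suc j) = int_poly_eval p (x (n - 1))" by auto
  obtain k where "x (n - 1) * x (Suc j) = of_nat k * x (Suc j) + x j"
    using x_mult[of "Suc j"] step by auto
  then have "x j = x (n - 1) * x (Suc j) - of_nat k * x (Suc j)" by simp
  also have "\<dots> = int_poly_eval (pCons 0 p + smult (- int k) p) (x (n - 1))"
    by (simp add: p int_poly_eval_add int_poly_eval_smult int_poly_eval_pCons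
        del: smult_minus_left add_uminus_conv_diff)
  finally show ?case by blast
qed

section \<open>The span of the \<open>x j\<close> as an algebra\<close>

abbreviation x_span :: "('w \<Rightarrow>\<^sub>0 rat) set" where
  "x_span \<equiv> group_algebra.span (x ` {l..n})"

lemma of_nat_mult_in_span: "v \<in> group_algebra.span B \<Longrightarrow> of_nat k * v \<in> group_algebra.span B"
  for v :: "'w \<Rightarrow>\<^sub>0 rat"
  by (simp add: of_nat_mult_eq_scale group_algebra.span_scale)

lemma x_in_span: "l \<le> j \<Longrightarrow> j \<le> n \<Longrightarrow> x j \<in> x_span"
  by (intro group_algebra.span_base) auto

lemma x_pred_top_mult_span:
  assumes "v \<in> x_span"
  shows "x (n - 1) * v \<in> x_span"
  using assms
proof (induction rule: group_algebra.span_induct_alt)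
  case base
  show ?case by (simp add: group_algebra.span_zero)
next
  case (step a y v)
  then obtain j where j: "l \<le> j" "j \<le> n" "y = x j" by auto
  have "x (n - 1) * y \<in> x_span"
  proof (cases "j = l")
    case True
    then obtain k where "x (n - 1) * y = of_nat k * y" using x_mult_bot j by metis
    then show ?thesis using j of_nat_mult_in_span x_in_span by simp
  next
    case False
    then obtain k where "x (n - 1) * y = of_nat k * y + x (j - 1)"
      using x_mult[of j] j by auto
    then show ?thesis
      using j False by (auto intro!: group_algebra.span_add of_nat_mult_in_span x_in_span)
  qed
  then show ?case
    using step by (simp add: distrib_left scale_mult_right group_algebra.span_add group_algebra.span_scale)
qed

text \<open>By the recursion, left multiplication by \<open>x j\<close> is composed of left
  multiplications by \<open>x (n - 1)\<close> and integers, which preserve the span.\<close>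

lemma x_mult_span:
  assumes "l \<le> j" "j \<le> n" "v \<in> x_span"
  shows "x j * v \<in> x_span"
  using assms(2,1)
proof (induction j rule: inc_induct)
  case base
  then show ?case using assms by (simp add: x_top)
next
  case (step j)
  obtain k where "x (n - 1) * x (Suc j) = of_nat k * x (Suc j) + x j"
    using x_mult[of "Suc j"] step by auto
  then have "x j = x (n - 1) * x (Suc j) - of_nat k * x (Suc j)" by simp
  then have "x j * v = x (n - 1) * (x (Suc j) * v) - of_nat k * (x (Suc j) * v)"
    by (simp add: left_diff_distrib mult.assoc)
  then show ?case
    using step of_nat_mult_in_span[of "x (Suc j) * v" _ k] x_pred_top_mult_span
    by (simp add: group_algebra.span_diff)
qed

lemma x_span_mult:
  assumes "u \<in> x_span" "v \<in> x_span"
  shows "u * v \<in> x_span"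
  using assms(1)
proof (induction rule: group_algebra.span_induct_alt)
  case base
  show ?case by (simp add: group_algebra.span_zero)
next
  case (step a y u)
  then have "y * v \<in> x_span" using x_mult_span assms(2) by auto
  then show ?case
    using step by (simp add: distrib_right scale_mult_left group_algebra.span_add group_algebra.span_scale)
qed

lemma x_in_unital_subalgebra:
  assumes A: "unital_subalgebra A" "x (n - 1) \<in> A" and "l \<le> j" "j \<le> n"
  shows "x j \<in> A"
  using assms(4,3)
proof (induction j rule: inc_induct)
  case base
  show ?case using A by (simp add: x_top unital_subalgebra_def)
next
  case (step j)
  have sub: "group_algebra.subspace A" and mult: "\<And>a b. a \<in> A \<Longrightarrow> b \<in> A \<Longrightarrow> a * b \<in> A"
    using A by (auto simp: unital_subalgebra_def subalgebra_def)
  obtain k where "x (n - 1) * x (Suc j) = of_nat k * x (Suc j) + x j"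
    using x_mult[of "Suc j"] step by auto
  then have "x j = x (n - 1) * x (Suc j) - scale (of_nat k) (x (Suc j))"
    by (simp add: of_nat_mult_eq_scale)
  then show ?case
    using step mult A(2) sub
    by (simp add: group_algebra.subspace_diff group_algebra.subspace_scale)
qed

lemma hull_eq_span: "unital_subalgebra hull {x (n - 1)} = x_span"
proof (rule hull_unique)
  show "{x (n - 1)} \<subseteq> x_span" using l_less by (auto intro: x_in_span)
  show "unital_subalgebra x_span"
    using x_span_mult x_in_span[of n] l_less
    by (auto simp: unital_subalgebra_def subalgebra_def group_algebra.subspace_span x_top)
  show "x_span \<subseteq> A" if "{x (n - 1)} \<subseteq> A" "unital_subalgebra A" for A
    using that x_in_unital_subalgebra[of A]
    by (intro group_algebra.span_minimal) (auto simp: unital_subalgebra_def subalgebra_def)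
qed

lemma native_basis_x: "native_basis S (unital_subalgebra hull {x (n - 1)}) (x ` {l..n})"
proof -
  have sub: "x ` {l..n} \<subseteq> {x_elem S J | J. J \<subseteq> S}"
    using J_sub_S by fastforce
  then show ?thesis
    unfolding native_basis_def hull_eq_span descent_algebra_def
    using x_independent[of l] l_less x_span_mult group_algebra.span_mono[OF sub]
    by (auto simp: subalgebra_def group_algebra.subspace_span)
qed

end

section \<open>Actions from the presentation\<close>

definition word_act :: "('w \<Rightarrow> 'a \<Rightarrow> 'a) \<Rightarrow> 'w list \<Rightarrow> 'a \<Rightarrow> 'a" where
  "word_act g us = foldr (\<lambda>t h. g t \<circ> h) us id"

lemma word_act_simps [simp]:
  "word_act g [] = id" "word_act g (t # us) = g t \<circ> word_act g us"
  by (simp_all add: word_act_def)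

lemma word_act_append: "word_act g (us @ vs) = word_act g us \<circ> word_act g vs"
  by (induction us) (simp_all add: o_assoc)

lemma word_act_relator: "word_act g (concat (replicate k [a, b])) = (g a \<circ> g b) ^^ k"
  by (induction k) (simp_all add: o_assoc)

definition presentation_act :: "'w::group_add set \<Rightarrow> ('w \<Rightarrow> 'a \<Rightarrow> 'a) \<Rightarrow> 'w \<Rightarrow> 'a \<Rightarrow> 'a" where
  "presentation_act S g w = word_act g (SOME us. us \<in> lists S \<and> sum_list us = w)"

text \<open>Two words for one element are linked by inserting and deleting relators, and these act
  trivially, so the word picked by \<open>SOME\<close> does not matter.\<close>

lemma presentation_act_word:
  assumes "coxeter_system S"
    and rel: "\<And>a b. a \<in> S \<Longrightarrow> b \<in> S \<Longrightarrow> (g a \<circ> g b) ^^ elem_order (a + b) = id"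
    and "us \<in> lists S"
  shows "presentation_act S g (sum_list us) = word_act g us"
proof -
  obtain vs where vs: "vs \<in> lists S" "sum_list vs = sum_list us"
    and act: "presentation_act S g (sum_list us) = word_act g vs"
    using someI[of "\<lambda>vs. vs \<in> lists S \<and> sum_list vs = sum_list us" us] assms(3)
    unfolding presentation_act_def by blast
  then have "equivclp (insert_relator S) vs us"
    using assms(1,3) by (simp add: coxeter_system_def)
  then have "word_act g vs = word_act g us"
  proof (induction rule: equivclp_induct)
    case (step y z)
    have inv: "word_act g u = word_act g v" if "insert_relator S u v" for u v
      using that by cases (simp add: word_act_append word_act_relator rel)
    show ?case using step(2,3) inv[of y z] inv[of z y] by auto
  qed simp
  then show ?thesis by (simp add: act)
qed

lemma presentation_act_add:
  assumes "coxeter_system S"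
    and "\<And>a b. a \<in> S \<Longrightarrow> b \<in> S \<Longrightarrow> (g a \<circ> g b) ^^ elem_order (a + b) = id"
  shows "presentation_act S g (v + w) = presentation_act S g v \<circ> presentation_act S g w"
proof -
  obtain us vs where "us \<in> lists S" "vs \<in> lists S" "sum_list us = v" "sum_list vs = w"
    using assms(1) unfolding coxeter_system_def by metis
  then show ?thesis
    using presentation_act_word[of S g us] presentation_act_word[of S g vs]
      presentation_act_word[of S g "us @ vs"] assms
    by (simp add: word_act_append)
qed

lemma presentation_act_zero:
  assumes "coxeter_system S"
    and "\<And>a b. a \<in> S \<Longrightarrow> b \<in> S \<Longrightarrow> (g a \<circ> g b) ^^ elem_order (a + b) = id"
  shows "presentation_act S g 0 = id"
  using presentation_act_word[of S g "[]"] assms by simp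

lemma presentation_act_gen:
  assumes "coxeter_system S"
    and "\<And>a b. a \<in> S \<Longrightarrow> b \<in> S \<Longrightarrow> (g a \<circ> g b) ^^ elem_order (a + b) = id"
    and "t \<in> S"
  shows "presentation_act S g t = g t"
  using presentation_act_word[of S g "[t]"] assms by simp

section \<open>Orders of elements\<close>

lemma sum_list_replicate_elem_order:
  assumes "elem_order w = k" "0 < k"
  shows "sum_list (replicate k w) = 0"
proof -
  have ex: "\<exists>k>0. sum_list (replicate k w) = 0"
    using assms by (auto simp: elem_order_def split: if_splits)
  then show ?thesis
    using LeastI_ex[of "\<lambda>k. k > 0 \<and> sum_list (replicate k w) = 0"] assms
    by (simp add: elem_order_def)
qed

lemma elem_order_zero: "elem_order 0 = 1"
proof -
  have "\<exists>k>0. sum_list (replicate k (0::'w::group_add)) = 0"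
    by (intro exI[of _ 1]) simp
  then show ?thesis
    by (auto simp: elem_order_def intro!: Least_equality)
qed

text \<open>For involutions \<open>s j + s i\<close> is the inverse of \<open>s i + s j\<close>, so
  the Coxeter matrix is only needed for \<open>i < j\<close>.\<close>

lemma elem_order_minus: "elem_order (- w) = elem_order w"
proof -
  have "sum_list (replicate k (- w)) = - sum_list (replicate k w)" for k
  proof (induction k)
    case (Suc k)
    have "sum_list (replicate k w) + w = w + sum_list (replicate k w)"
      by (induction k) (simp_all add: add.assoc)
    then show ?case using Suc by (simp only: replicate_Suc sum_list.Cons minus_add)
        (simp only: minus_add[symmetric])
  qed simp
  then show ?thesis by (simp only: elem_order_def neg_equal_0_iff_equal)
qed

section \<open>Signed permutations\<close>

text \<open>For \<open>b = - a\<close> the first two cases cover both points and the map is a sign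
  change; \<open>b = - 2\<close> with \<open>a = 1\<close> gives the extra generator of type
  D.\<close>

definition signed_transp :: "int \<Rightarrow> int \<Rightarrow> int \<Rightarrow> int" where
  "signed_transp a b x =
    (if x = a then b else if x = b then a else if x = - a then - b else if x = - b then - a else x)"

lemma signed_transp_involution:
  assumes "a \<noteq> 0" "b \<noteq> 0" "a \<noteq> b"
  shows "signed_transp a b \<circ> signed_transp a b = id"
proof
  fix x
  consider "x = a" | "x = b" | "x = - a" | "x = - b"
    | "x \<noteq> a" "x \<noteq> b" "x \<noteq> - a" "x \<noteq> - b" by blast
  then show "(signed_transp a b \<circ> signed_transp a b) x = id x"
    using assms by cases (simp_all add: signed_transp_def)
qed

lemma signed_transp_other: "\<bar>x\<bar> \<noteq> \<bar>a\<bar> \<Longrightarrow> \<bar>x\<bar> \<noteq> \<bar>b\<bar> \<Longrightarrow> signed_transp a b x = x"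
  by (auto simp: signed_transp_def)

lemma abs_signed_transp: "\<bar>x\<bar> = \<bar>a\<bar> \<or> \<bar>x\<bar> = \<bar>b\<bar> \<Longrightarrow>
    \<bar>signed_transp a b x\<bar> = \<bar>a\<bar> \<or> \<bar>signed_transp a b x\<bar> = \<bar>b\<bar>"
  by (auto simp: signed_transp_def abs_eq_iff)

text \<open>The supports are disjoint even up to sign, so the two involutions commute.\<close>

lemma signed_transp_commute:
  assumes "a \<noteq> 0" "b \<noteq> 0" "a \<noteq> b" "c \<noteq> 0" "d \<noteq> 0" "c \<noteq> d"
    and "\<bar>a\<bar> \<noteq> \<bar>c\<bar>" "\<bar>a\<bar> \<noteq> \<bar>d\<bar>" "\<bar>b\<bar> \<noteq> \<bar>c\<bar>" "\<bar>b\<bar> \<noteq> \<bar>d\<bar>"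
  shows "(signed_transp a b \<circ> signed_transp c d) ^^ 2 = id"
proof
  fix x
  let ?f = "signed_transp a b" and ?g = "signed_transp c d"
  have comm: "?f (?g y) = ?g (?f y)" for y
  proof -
    consider "\<bar>y\<bar> = \<bar>a\<bar> \<or> \<bar>y\<bar> = \<bar>b\<bar>" | "\<bar>y\<bar> = \<bar>c\<bar> \<or> \<bar>y\<bar> = \<bar>d\<bar>"
      | "\<bar>y\<bar> \<noteq> \<bar>a\<bar>" "\<bar>y\<bar> \<noteq> \<bar>b\<bar>" "\<bar>y\<bar> \<noteq> \<bar>c\<bar>" "\<bar>y\<bar> \<noteq> \<bar>d\<bar>" by blast
    then show ?thesis
    proof cases
      case 1
      then have "?g y = y" "?g (?f y) = ?f y"
        using assms(7-10) abs_signed_transp[OF 1] signed_transp_other[of _ c d] by metis+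
      then show ?thesis by simp
    next
      case 2
      then have "?f y = y" "?f (?g y) = ?g y"
        using assms(7-10) abs_signed_transp[OF 2] signed_transp_other[of _ a b] by metis+
      then show ?thesis by simp
    qed (simp add: signed_transp_other)
  qed
  have "?f (?f y) = y" "?g (?g y) = y" for y
    using signed_transp_involution[of a b] signed_transp_involution[of c d] assms(1-6)
    by (auto dest: fun_cong[of _ _ y])
  then show "((?f \<circ> ?g) ^^ 2) x = id x"
    by (simp add: numeral_2_eq_2 comm[of "?g x", symmetric])
qed

text \<open>The composite is a 3-cycle on \<open>a, b, c\<close> and on their negatives.\<close>

lemma signed_transp_braid:
  assumes "0 < a" "a < b" "b < c"
  shows "(signed_transp a b \<circ> signed_transp b c) ^^ 3 = id"
proof
  fix x
  consider "x = a" | "x = b" | "x = c" | "x = - a" | "x = - b" | "x = - c"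
    | "x \<noteq> a" "x \<noteq> b" "x \<noteq> c" "x \<noteq> - a" "x \<noteq> - b" "x \<noteq> - c" by blast
  then show "((signed_transp a b \<circ> signed_transp b c) ^^ 3) x = id x"
    using assms by cases (simp_all add: signed_transp_def numeral_3_eq_3)
qed

text \<open>In type A the group permutes the points \<open>1, \<dots>, n + 1\<close>, in types B and D the points \<open>\<plusminus>1, \<dots>, \<plusminus>n\<close>.\<close>

fun perm_gen :: "cox_series \<Rightarrow> nat \<Rightarrow> int \<Rightarrow> int" where
  "perm_gen A_series i = signed_transp (int i) (int i + 1)"
| "perm_gen B_series i = (if i = 1 then signed_transp 1 (- 1) else signed_transp (int i - 1) (int i))"
| "perm_gen D_series i = (if i = 1 then signed_transp 1 (- 2) else signed_transp (int i - 1) (int i))"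

lemma perm_gen_involution: "1 \<le> i \<Longrightarrow> perm_gen T i \<circ> perm_gen T i = id"
  by (cases T) (simp_all add: signed_transp_involution)

lemma perm_gen_relation:
  assumes "1 \<le> i" "i < j"
  shows "(perm_gen T i \<circ> perm_gen T j) ^^ cox_entry T i j = id"
proof (cases T)
  case A_series
  show ?thesis
  proof (cases "j = i + 1")
    case True
    then show ?thesis
      using A_series assms signed_transp_braid[of "int i" "int i + 1" "int i + 2"]
      by (simp add: add.commute)
  next
    case False
    then show ?thesis
      using A_series assms signed_transp_commute[of "int i" "int i + 1" "int j" "int j + 1"] by simp
  qed
next
  case B_series
  \<comment> \<open>The composite is the 4-cycle \<open>1, 2, - 1, - 2\<close>.\<close>
  have m4: "(signed_transp 1 (- 1) \<circ> signed_transp 1 2) ^^ 4 = id"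
  proof
    fix x :: int
    consider "x = 1" | "x = 2" | "x = - 1" | "x = - 2"
      | "x \<noteq> 1" "x \<noteq> 2" "x \<noteq> - 1" "x \<noteq> - 2" by blast
    then show "((signed_transp 1 (- 1) \<circ> signed_transp 1 2) ^^ 4) x = id x"
      by cases (simp_all add: signed_transp_def numeral_eq_Suc)
  qed
  consider "i = 1" "j = 2" | "i = 1" "j > 2" | "i > 1" "j = i + 1" | "i > 1" "j > i + 1"
    using assms by linarith
  then show ?thesis
  proof cases
    case 1
    then show ?thesis using B_series m4 by simp
  next
    case 2
    then show ?thesis
      using B_series signed_transp_commute[of 1 "- 1" "int j - 1" "int j"] by simp
  next
    case 3
    then show ?thesis
      using B_series signed_transp_braid[of "int i - 1" "int i" "int i + 1"] by (simp add: add.commute)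
  next
    case 4
    then show ?thesis
      using B_series signed_transp_commute[of "int i - 1" "int i" "int j - 1" "int j"] by simp
  qed
next
  case D_series
  \<comment> \<open>The composite negates 1 and 2. The supports coincide, so
    \<open>signed_transp_commute\<close> does not apply.\<close>
  have m2: "(signed_transp 1 (- 2) \<circ> signed_transp 1 2) ^^ 2 = id"
  proof
    fix x :: int
    consider "x = 1" | "x = 2" | "x = 3" | "x = - 1" | "x = - 2" | "x = - 3"
      | "x \<noteq> 1" "x \<noteq> 2" "x \<noteq> 3" "x \<noteq> - 1" "x \<noteq> - 2" "x \<noteq> - 3" by blast
    then show "((signed_transp 1 (- 2) \<circ> signed_transp 1 2) ^^ 2) x = id x"
      by cases (simp_all add: signed_transp_def numeral_eq_Suc)
  qed
  \<comment> \<open>A 3-cycle on \<open>1, - 2, - 3\<close> and on their negatives; the mixed signs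
    fall outside \<open>signed_transp_braid\<close>.\<close>
  have m3: "(signed_transp 1 (- 2) \<circ> signed_transp 2 3) ^^ 3 = id"
  proof
    fix x :: int
    consider "x = 1" | "x = 2" | "x = 3" | "x = - 1" | "x = - 2" | "x = - 3"
      | "x \<noteq> 1" "x \<noteq> 2" "x \<noteq> 3" "x \<noteq> - 1" "x \<noteq> - 2" "x \<noteq> - 3" by blast
    then show "((signed_transp 1 (- 2) \<circ> signed_transp 2 3) ^^ 3) x = id x"
      by cases (simp_all add: signed_transp_def numeral_eq_Suc)
  qed
  consider "i = 1" "j = 2" | "i = 1" "j = 3" | "i = 1" "j > 3"
    | "i > 1" "j = i + 1" | "i > 1" "j > i + 1"
    using assms by linarith
  then show ?thesis
  proof cases
    case 1
    then show ?thesis using D_series m2 by simp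
  next
    case 2
    then show ?thesis using D_series m3 by simp
  next
    case 3
    then show ?thesis
      using D_series signed_transp_commute[of 1 "- 2" "int j - 1" "int j"] by simp
  next
    case 4
    then show ?thesis
      using D_series signed_transp_braid[of "int i - 1" "int i" "int i + 1"] by (simp add: add.commute)
  next
    case 5
    then show ?thesis
      using D_series signed_transp_commute[of "int i - 1" "int i" "int j - 1" "int j"] by simp
  qed
qed

text \<open>Conjugation by the involution \<open>g\<close> reverses the order of the factors; this
  serves the relators of pairs with decreasing indices.\<close>

lemma funpow_comp_swap:
  assumes "(f \<circ> g) ^^ k = id" "g \<circ> g = id"
  shows "(g \<circ> f) ^^ k = id"
proof -
  have "(g \<circ> f) ^^ k \<circ> g = g \<circ> (f \<circ> g) ^^ k"
    by (induction k) (simp_all add: fun_eq_iff)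
  then have "(g \<circ> f) ^^ k \<circ> (g \<circ> g) = g \<circ> g"
    using assms(1) by (metis comp_id o_assoc)
  then show ?thesis using assms(2) by simp
qed

definition base_index :: "cox_series \<Rightarrow> nat" where
  "base_index T = (if T = D_series then 1 else 0)"

text \<open>In type A the group \<open>W\<^sub>m\<close> permutes \<open>m + 1\<close> points, so
  the point that distinguishes cosets is \<open>m + 1\<close> instead of \<open>m\<close>.\<close>

definition point_shift :: "cox_series \<Rightarrow> int" where
  "point_shift T = (if T = A_series then 1 else 0)"

section \<open>The types A, B and D\<close>

locale coxeter_type =
  fixes T :: cox_series and n :: nat and S :: "'w::group_add set" and s :: "nat \<Rightarrow> 'w"
  assumes type: "coxeter_system_of_type T n S s"
begin

lemma rank: "min_rank T \<le> n" and system: "coxeter_system S" and bij: "bij_betw s {1..n} S"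
  and order: "\<And>i j. 1 \<le> i \<Longrightarrow> i < j \<Longrightarrow> j \<le> n \<Longrightarrow> elem_order (s i + s j) = cox_entry T i j"
  using type by (simp_all add: coxeter_system_of_type_def)

lemma S_eq: "S = s ` {1..n}"
  using bij by (simp add: bij_betw_def)

lemma s_mem: "1 \<le> i \<Longrightarrow> i \<le> n \<Longrightarrow> s i \<in> S"
  by (simp add: S_eq)

lemma s_eq_iff: "1 \<le> i \<Longrightarrow> i \<le> n \<Longrightarrow> 1 \<le> j \<Longrightarrow> j \<le> n \<Longrightarrow> s i = s j \<longleftrightarrow> i = j"
  using inj_on_eq_iff[OF bij_betw_imp_inj_on[OF bij]] by simp

lemma S_involution: "t \<in> S \<Longrightarrow> t + t = 0" and S_nonzero: "t \<in> S \<Longrightarrow> t \<noteq> 0"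
proof -
  assume "t \<in> S"
  then have o: "elem_order t = 2" using system by (simp add: coxeter_system_def)
  show "t + t = 0"
    using sum_list_replicate_elem_order[OF o] by (simp add: numeral_2_eq_2)
  have "elem_order (0 :: 'w) \<noteq> 2" by (simp add: elem_order_zero)
  with o show "t \<noteq> 0" by metis
qed

lemma gen_eq_UNIV: "gen S = UNIV"
proof -
  have "w \<in> gen S" for w
    using system unfolding coxeter_system_def gen_def by (metis image_eqI)
  then show ?thesis by blast
qed

lemma s_involution: "1 \<le> i \<Longrightarrow> i \<le> n \<Longrightarrow> s i + s i = 0"
  and s_involution_left: "1 \<le> i \<Longrightarrow> i \<le> n \<Longrightarrow> s i + (s i + w) = w"
  by (simp_all add: S_involution s_mem flip: add.assoc)

lemma s_minus: "1 \<le> i \<Longrightarrow> i \<le> n \<Longrightarrow> - s i = s i"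
  using s_involution by (simp add: minus_unique)

lemma s_relation:
  "1 \<le> i \<Longrightarrow> i < j \<Longrightarrow> j \<le> n \<Longrightarrow> 0 < cox_entry T i j \<Longrightarrow>
    sum_list (replicate (cox_entry T i j) (s i + s j)) = 0"
  by (intro sum_list_replicate_elem_order order)

lemma s_commute:
  assumes "1 \<le> i" "i < j" "j \<le> n" "cox_entry T i j = 2"
  shows "s i + s j = s j + s i"
proof -
  have "(s i + s j) + (s i + s j) = 0"
    using s_relation[of i j] assms by (simp add: numeral_2_eq_2)
  then have "s i + s j = - (s i + s j)" by (metis minus_unique)
  then show ?thesis using assms by (simp add: minus_add s_minus)
qed

lemma s_braid:
  assumes "1 \<le> i" "i < j" "j \<le> n" "cox_entry T i j = 3"
  shows "s i + s j + s i = s j + s i + s j"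
proof -
  have "(s i + s j + s i) + (s j + s i + s j) = 0"
    using s_relation[of i j] assms by (simp add: numeral_3_eq_3 add.assoc)
  then have "s i + s j + s i = - (s j + s i + s j)" by (simp add: eq_neg_iff_add_eq_0)
  then show ?thesis using assms by (simp add: minus_add s_minus add.assoc)
qed

section \<open>The action by signed permutations\<close>

definition perm_act :: "'w \<Rightarrow> int \<Rightarrow> int" where
  "perm_act = presentation_act S (\<lambda>w. perm_gen T (inv_into {1..n} s w))"

lemma perm_act_relation:
  assumes "a \<in> S" "b \<in> S"
  shows "(perm_gen T (inv_into {1..n} s a) \<circ> perm_gen T (inv_into {1..n} s b)) ^^ elem_order (a + b) = id"
proof -
  obtain i j where ij: "1 \<le> i" "i \<le> n" "a = s i" "1 \<le> j" "j \<le> n" "b = s j"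
    using assms by (auto simp: S_eq)
  then have inv: "inv_into {1..n} s a = i" "inv_into {1..n} s b = j"
    using bij by (auto simp: bij_betw_def intro: inv_into_f_f)
  consider "i = j" | "i < j" | "j < i" by linarith
  then show ?thesis
  proof cases
    case 1
    then show ?thesis
      unfolding inv using ij perm_gen_involution[of i T] by (simp add: s_involution elem_order_zero)
  next
    case 2
    then show ?thesis
      unfolding inv using ij perm_gen_relation[of i j T] by (simp add: order)
  next
    case 3
    have "a + b = - (s j + s i)" using ij by (simp add: minus_add s_minus)
    then have "elem_order (a + b) = cox_entry T j i"
      using 3 ij by (simp add: elem_order_minus order)
    then show ?thesis
      unfolding inv using 3 ij perm_gen_relation[of j i T] perm_gen_involution[of i T]
      by (simp add: funpow_comp_swap)
  qed
qed

lemma perm_act_zero: "perm_act 0 = id"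
  unfolding perm_act_def by (rule presentation_act_zero[OF system perm_act_relation])

lemma perm_act_add: "perm_act (v + w) = perm_act v \<circ> perm_act w"
  unfolding perm_act_def by (rule presentation_act_add[OF system perm_act_relation])

lemma perm_act_s: "1 \<le> i \<Longrightarrow> i \<le> n \<Longrightarrow> perm_act (s i) = perm_gen T i"
  using presentation_act_gen[OF system perm_act_relation s_mem, of i] bij
  by (simp add: perm_act_def bij_betw_def inv_into_f_f)

lemma base_index_less: "base_index T < n"
  using rank by (cases T) (auto simp: base_index_def)

abbreviation gens :: "nat \<Rightarrow> 'w set" where "gens \<equiv> left_connected_gens T s"

lemma gens_eq: "gens j = (if j \<le> base_index T then {} else s ` {1..j})" if "base_index T \<le> j"
  using that by (auto simp: left_connected_gens_def base_index_def)

lemma gens_Suc: "base_index T < m \<Longrightarrow> gens (Suc m) = insert (s (Suc m)) (gens m)"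
  by (simp add: gens_eq atLeastAtMostSuc_conv)

lemma s_commute_gens:
  assumes "base_index T < m" "m < n" "t \<in> gens (m - 1)"
  shows "s (Suc m) + t = t + s (Suc m)"
proof -
  obtain i where i: "1 \<le> i" "i \<le> m - 1" "t = s i" "base_index T < m - 1"
    using assms by (auto simp: gens_eq split: if_splits)
  then have "cox_entry T i (Suc m) = 2"
    by (cases T) (auto simp: base_index_def)
  then show ?thesis using s_commute[of i "Suc m"] i assms by simp
qed

lemma s_braid_Suc:
  assumes "Suc (base_index T) < m" "m < n"
  shows "s m + s (Suc m) + s m = s (Suc m) + s m + s (Suc m)"
proof -
  have "cox_entry T m (Suc m) = 3"
    using assms(1) by (cases T) (auto simp: base_index_def)
  then show ?thesis using s_braid[of m "Suc m"] assms by simp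
qed

lemma perm_act_fix:
  assumes "base_index T < m" "m \<le> n" "t \<in> gens (m - 1)"
  shows "perm_act t (int m + point_shift T) = int m + point_shift T"
proof -
  obtain i where i: "1 \<le> i" "i \<le> m - 1" "t = s i" "base_index T < m - 1"
    using assms by (auto simp: gens_eq split: if_splits)
  have "perm_gen T i (int m + point_shift T) = int m + point_shift T"
    using i assms(1) by (cases T) (auto simp: base_index_def point_shift_def signed_transp_def)
  then show ?thesis using i assms by (simp add: perm_act_s)
qed

lemma perm_act_step:
  assumes "Suc (base_index T) < m" "m \<le> n"
  shows "perm_act (s m) (int m + point_shift T) = int m - 1 + point_shift T"
    and "perm_act (s m) (- (int m - 1 + point_shift T)) = - (int m + point_shift T)"
proof -
  have "perm_gen T m (int m + point_shift T) = int m - 1 + point_shift T"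
    "perm_gen T m (- (int m - 1 + point_shift T)) = - (int m + point_shift T)"
    using assms(1) by (cases T; simp add: base_index_def point_shift_def signed_transp_def)+
  then show "perm_act (s m) (int m + point_shift T) = int m - 1 + point_shift T"
    and "perm_act (s m) (- (int m - 1 + point_shift T)) = - (int m + point_shift T)"
    using assms by (simp_all add: perm_act_s)
qed

section \<open>The three series as instances of the chain\<close>

lemma gens_bot: "gens (base_index T) = {}"
  by (simp add: gens_eq)

lemma gens_top: "gens n = S"
  using base_index_less by (simp add: gens_eq S_eq)

text \<open>The part of the chain axioms that is uniform in \<open>T\<close> is discharged here;
  what remains concerns the base group and its interaction with the next generator.\<close>

lemma chain_intro:
  assumes l: "l = base_index T" and c: "c = point_shift T"
    and "finite K" "finite E0" "K \<subseteq> gens (Suc l)" "E0 \<subseteq> gen (gens (Suc l))"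
    and "E0 = {} \<or> (\<exists>e. E0 = {e})" "\<And>e. e \<in> E0 \<Longrightarrow> e + e = 0"
    and "0 \<notin> K" "0 \<notin> E0" "K \<inter> E0 = {}"
    and "s (Suc l) \<in> K \<union> E0"
    and "\<And>k. Suc l < n \<Longrightarrow> k \<in> K \<Longrightarrow>
      k + s (Suc (Suc l)) + k = s (Suc (Suc l)) + k + s (Suc (Suc l))"
    and "\<And>t d. t \<in> gens (Suc l) \<Longrightarrow> d \<in> insert 0 (K \<union> E0) \<Longrightarrow>
      t + d \<in> insert 0 (K \<union> E0) \<and> d + t \<in> insert 0 (K \<union> E0)"
    and "\<And>e. Suc l < n \<Longrightarrow> e \<in> E0 \<Longrightarrow>
      normalizes (s (Suc (Suc l)) + e + s (Suc (Suc l))) (gens (Suc l)) \<and>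
      normalizes (s (Suc (Suc l)) + e + s (Suc (Suc l))) K \<and>
      normalizes (s (Suc (Suc l)) + e + s (Suc (Suc l))) E0"
    and "inj_on (\<lambda>d. perm_act d (int (Suc l) + c)) (insert 0 (K \<union> E0))"
    and "\<And>d. d \<in> K \<Longrightarrow> \<bar>perm_act d (int (Suc l) + c)\<bar> \<le> int (Suc l) + c"
    and "\<And>e. e \<in> E0 \<Longrightarrow> perm_act e (int (Suc l) + c) = - (int (Suc l) + c)"
  shows "left_connected_chain S s gens K E0 l n perm_act c"
  unfolding l c
proof (rule left_connected_chain.intro)
  show "s (Suc (base_index T)) \<in> gens (Suc (base_index T))" by (simp add: gens_eq)
  show "0 \<le> point_shift T" by (simp add: point_shift_def)
qed (rule base_index_less gens_bot gens_top gens_Suc gen_eq_UNIV S_involution S_nonzero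
    s_commute_gens s_braid_Suc perm_act_zero perm_act_add perm_act_fix perm_act_step
    assms(3-)[unfolded l c]; assumption)+

text \<open>\<open>s 1\<close> sends the point 2 to 1, and no element of the base group negates 2,
  so there is no top element.\<close>

lemma chain_A:
  assumes T: "T = A_series"
  shows "left_connected_chain S s gens {s 1} {} 0 n perm_act 1"
proof -
  have n: "1 \<le> n" using rank T by simp
  have l: "base_index T = 0" "point_shift T = 1" by (simp_all add: T base_index_def point_shift_def)
  have J: "gens (Suc 0) = {s 1}" by (simp add: gens_eq l)
  have "perm_gen T 1 2 = 1" using T by (simp add: signed_transp_def)
  then have act: "perm_act (s 1) 2 = 1"
    using perm_act_s[of 1] n by simp
  have braid: "s 1 + s 2 + s 1 = s 2 + s 1 + s 2" if "Suc 0 < n"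
    using s_braid[of 1 2] that T by simp
  have s: "s 1 + s 1 = 0" "s 1 \<noteq> 0" using n s_involution S_nonzero s_mem by auto
  show ?thesis
  \<comment> \<open>Cases are numbered by the hypotheses of \<open>chain_intro\<close>; 14 is
    closure of the base under its generators.\<close>
  proof (rule chain_intro, goal_cases)
    case (14 t d)
    then show ?case using s unfolding J by auto
  qed (use s braid act in \<open>simp_all add: l J perm_act_zero numeral_2_eq_2\<close>)
qed

text \<open>\<open>s 1\<close> negates the point 1, so it is itself the top element and belongs to
  \<open>E0\<close>.\<close>

lemma chain_B:
  assumes T: "T = B_series"
  shows "left_connected_chain S s gens {} {s 1} 0 n perm_act 0"
proof -
  have n: "2 \<le> n" using rank T by simp
  have l: "base_index T = 0" "point_shift T = 0" by (simp_all add: T base_index_def point_shift_def)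
  have J: "gens (Suc 0) = {s 1}" by (simp add: gens_eq l)
  have "perm_gen T 1 1 = - 1" using T by (simp add: signed_transp_def)
  then have act: "perm_act (s 1) 1 = - 1"
    using perm_act_s[of 1] n by simp
  have s: "s 1 + s 1 = 0" "s 1 \<noteq> 0" using n s_involution S_nonzero s_mem by auto
  \<comment> \<open>The relation of order 4 gives \<open>?w = - ?w\<close>, which says that
    \<open>s 2 + s 1 + s 2\<close> commutes with \<open>s 1\<close>.\<close>
  let ?w = "s 1 + s 2 + s 1 + s 2"
  have "?w + ?w = 0"
    using s_relation[of 1 2] n T by (simp add: numeral_eq_Suc add.assoc)
  then have "?w = - ?w" by (simp add: eq_neg_iff_add_eq_0)
  also have "- ?w = s 2 + s 1 + s 2 + s 1"
    using n by (simp add: minus_add s_minus add.assoc del: minus_add_distrib add_uminus_conv_diff)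
  finally have "normalizes (s 2 + s 1 + s 2) {s 1}"
    by (intro normalizes_commuting) (simp add: add.assoc)
  moreover have "normalizes e {}" for e :: 'w
    by (rule normalizes_commuting) simp
  ultimately have N: "normalizes (s 2 + s 1 + s 2) {s 1} \<and> normalizes (s 2 + s 1 + s 2) {}"
    by blast
  show ?thesis
  proof (rule chain_intro, goal_cases)
    case (14 t d)
    then show ?case using s unfolding J by auto
  qed (use s N act in \<open>simp_all add: l J perm_act_zero numeral_2_eq_2 gen_incl\<close>)
qed

text \<open>The base is the Klein four-group of \<open>s 1\<close> and \<open>s 2\<close>. Its
  elements \<open>s 1\<close>, \<open>s 2\<close>, \<open>s 1 + s 2\<close> send the point 2 to -1,
  1, -2, so the last one is the top element.\<close>

lemma chain_D:
  assumes T: "T = D_series"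
  shows "left_connected_chain S s gens {s 1, s 2} {s 1 + s 2} 1 n perm_act 0"
proof -
  have n: "3 \<le> n" using rank T by simp
  have l: "base_index T = 1" "point_shift T = 0" by (simp_all add: T base_index_def point_shift_def)
  have "{1..2} = {1, 2::nat}" by (rule set_eqI) (simp, presburger)
  then have J: "gens 2 = {s 1, s 2}" by (simp add: gens_eq l)
  have "perm_gen T 1 2 = - 1" "perm_gen T 2 2 = 1" "perm_gen T 1 1 = - 2"
    using T by (simp_all add: signed_transp_def)
  then have act: "perm_act (s 1) 2 = - 1" "perm_act (s 2) 2 = 1" "perm_act (s 1) 1 = - 2"
    using perm_act_s[of 1] perm_act_s[of 2] n by simp_all
  have s: "s 1 + s 1 = 0" "s 2 + s 2 = 0" "s 1 \<noteq> 0" "s 2 \<noteq> 0" "s 1 \<noteq> s 2"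
    using n s_involution[of 1] s_involution[of 2] S_nonzero[OF s_mem[of 1]] S_nonzero[OF s_mem[of 2]]
      s_eq_iff[of 1 2]
    by simp_all
  \<comment> \<open>Keeps \<open>s 1\<close> from turning into \<open>s (Suc 0)\<close>, so that the
    facts about \<open>s 1\<close> keep matching.\<close>
  note One_nat_def [simp del]
  have sl: "s 1 + (s 1 + w) = w" "s 2 + (s 2 + w) = w" for w
    using n s_involution_left by simp_all
  have c: "s 2 + s 1 = s 1 + s 2"
    using s_commute[of 1 2] n T by simp
  then have cl: "s 2 + (s 1 + w) = s 1 + (s 2 + w)" for w
    by (simp flip: add.assoc)
  have b: "s 1 + s 3 + s 1 = s 3 + s 1 + s 3" "s 2 + s 3 + s 2 = s 3 + s 2 + s 3"
    using s_braid[of 1 3] s_braid[of 2 3] n T by simp_all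
  \<comment> \<open>Two braid moves show that conjugation by \<open>e\<close> exchanges
    \<open>s 1\<close> and \<open>s 2\<close>: it normalizes the pair without fixing its
    members.\<close>
  define e where "e = s 3 + (s 1 + s 2) + s 3"
  have e2: "e + s 2 = s 1 + e"
  proof -
    have "e + s 2 = s 3 + s 1 + (s 2 + s 3 + s 2)" by (simp only: e_def add.assoc)
    also have "\<dots> = (s 3 + s 1 + s 3) + s 2 + s 3" by (simp only: b(2)) (simp only: add.assoc)
    also have "\<dots> = s 1 + e" by (simp only: b(1)[symmetric]) (simp only: e_def add.assoc)
    finally show ?thesis .
  qed
  have e1: "e + s 1 = s 2 + e"
  proof -
    have "e + s 1 = s 3 + s 2 + (s 1 + s 3 + s 1)" by (simp only: e_def add.assoc cl)
    also have "\<dots> = (s 3 + s 2 + s 3) + s 1 + s 3" by (simp only: b(1)) (simp only: add.assoc)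
    also have "\<dots> = s 2 + e" by (simp only: b(2)[symmetric]) (simp only: e_def add.assoc cl)
    finally show ?thesis .
  qed
  have N: "normalizes e {s 1, s 2}"
    unfolding normalizes_def by (simp only: image_insert image_empty e1 e2 insert_commute)
  have "e + (s 1 + s 2) = (e + s 1) + s 2" by (simp only: add.assoc)
  also have "\<dots> = s 2 + (e + s 2)" by (simp only: e1 add.assoc)
  also have "\<dots> = (s 2 + s 1) + e" by (simp only: e2 add.assoc)
  finally have N': "normalizes e {s 1 + s 2}"
    by (simp add: normalizes_def c)
  have ne: "s 1 + s 2 \<noteq> 0" "s 1 + s 2 \<noteq> s 1" "s 1 + s 2 \<noteq> s 2"
  proof -
    show "s 1 + s 2 \<noteq> 0"
    proof
      assume "s 1 + s 2 = 0"
      then have "s 1 + (s 1 + s 2) = s 1" by simp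
      then show False using s(5) sl(1) by simp
    qed
    show "s 1 + s 2 \<noteq> s 1"
    proof
      assume "s 1 + s 2 = s 1"
      then have "s 1 + (s 1 + s 2) = 0" using s(1) by simp
      then show False using s(4) sl(1) by simp
    qed
    show "s 1 + s 2 \<noteq> s 2" using s(3) by (metis add_0 add_right_cancel)
  qed
  have inj: "inj_on (\<lambda>d. perm_act d 2) (insert 0 ({s 1, s 2} \<union> {s 1 + s 2}))"
    by (rule inj_onI) (auto simp: act perm_act_zero perm_act_add)
  show ?thesis
  proof (rule chain_intro, goal_cases)
    case 6
    show ?case by (simp add: J gen_add gen_incl)
  next
    case (14 t d)
    then show ?case by (auto simp: J s sl c cl add.assoc)
  next
    case 15
    then show ?case using N N' by (simp add: J e_def)
  next
    case 16
    then show ?case using inj by simp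
  next
    case 8
    then show ?case by (auto simp: add.assoc cl sl s)
  next
    case (13 k)
    then show ?case using b by auto
  next
    case (17 d)
    then show ?case by (auto simp: act)
  qed (use s ne in \<open>simp_all add: J l act perm_act_add\<close>)
qed

lemma chain:
  obtains K E0 l c where "left_connected_chain S s gens K E0 l n perm_act c"
    "left_connected_indices T n = {l..n}"
  using that chain_A chain_B chain_D by (cases T) auto

end

theorem theorem3p13:
  fixes S :: "'w::group_add set" and s :: "nat \<Rightarrow> 'w" and n :: nat and T :: cox_series
  assumes "coxeter_system_of_type T n S s"
  shows "native_basis S (left_connected_algebra T n S s)
           (x_left T S s ` left_connected_indices T n) \<and>
         (\<forall>j\<in>left_connected_indices T n.
            \<exists>p :: int poly. x_left T S s j = int_poly_eval p (x_left T S s (n - 1)))"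
proof -
  interpret coxeter_type T n S s by unfold_locales (rule assms)
  obtain K E0 l c where "left_connected_chain S s gens K E0 l n perm_act c"
    and I: "left_connected_indices T n = {l..n}"
    by (rule chain)
  then interpret left_connected_chain S s gens K E0 l n perm_act c by simp
  have "x_left T S s = x" by (simp add: fun_eq_iff x_left_def)
  then show ?thesis
    using native_basis_x x_int_poly by (simp add: I left_connected_algebra_def)
qed

end
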